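(* Let $\mu$ be the probability measure on $\mathcal{C}_n=\{-1,1\}^n$ given by $\mu(x)\propto\exp(T(x))$, for some positive definite symmetric degree-$4$ tensor $T\in(\mathbb{R}^n)^{\otimes4}$. Assume that $\|T\|_{\mathrm{inj}}\le\frac{1}{56n}$. Then the Poincaré constant of $\mu$ for Glauber dynamics satisfies $$C_{\mathrm{P}}(\mu)\le\frac{1}{1-56\,n\,\|T\|_{\mathrm{inj}}}.$$
   Context: A tensor $T\in(\mathbb{R}^n)^{\otimes 4}$ is symmetric if its entries are invariant under all permutations of the indices. It is identified with the multilinear form $T(x,y,z,w)=\sum T_{i_1i_2i_3i_4}x_{i_1}y_{i_2}z_{i_3}w_{i_4}$, and $T(x):=T(x,x,x,x)$. It is also identified with a linear operator on $n\times n$ matrices (an $n^2\times n^2$ matrix) through $T(x,y,z,w)=\langle x\otimes y,T(z\otimes w)\rangle_{\mathrm{HS}}$, with $x\otimes y=xy^T$ and $\langle A,B\rangle_{\mathrm{HS}}=\mathrm{Tr}(A^TB)$; positive definite means positive definite as an $n^2\times n^2$ matrix. The injective norm is $\|T\|_{\mathrm{inj}}=\sup\{|T(x,y,z,w)|:\|x\|_2=\|y\|_2=\|z\|_2=\|w\|_2=1\}$. $f_1\propto f_2$ means equality up to a positive constant independent of $x$. Glauber dynamics for $\mu$ is run in continuous time with updates at the times of a Poisson process of intensity $n$ (each coordinate is resampled from its conditional law given the others at rate $1$). Its Dirichlet form is $$\mathcal{E}_\mu(\varphi)=\frac12\sum_{x\in\mathcal{C}_n}\sum_{i=1}^n(\varphi(x)-\varphi(x^{(i)}))^2\frac{\mu(x)\mu(x^{(i)})}{\mu(x)+\mu(x^{(i)})},$$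 where $x^{(i)}$ is $x$ with the $i$-th coordinate flipped. $C_{\mathrm{P}}(\mu)$ is the smallest constant $C$ such that $\mathrm{Var}_\mu(\varphi)\le C\,\mathcal{E}_\mu(\varphi)$ for all $\varphi:\mathcal{C}_n\to\mathbb{R}$. *)

theory Defs
  imports "HOL-Probability.Probability" "HOL-Combinatorics.Permutations"
begin

text \<open>
  The dimension \<open>n\<close> is \<open>CARD('n)\<close> for a finite index type \<open>'n\<close>; tensors of degree 4 are
  elements of \<open>real ^ 'n ^ 'n ^ 'n ^ 'n\<close> and \<open>n \<times> n\<close> matrices elements of \<open>real ^ 'n ^ 'n\<close>.
\<close>

type_synonym 'n tensor4 = "real ^ 'n ^ 'n ^ 'n ^ 'n"

definition symmetric_tensor :: "'n::finite tensor4 \<Rightarrow> bool" where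
  "symmetric_tensor T \<longleftrightarrow>
     (\<forall>p (i :: nat \<Rightarrow> 'n). p permutes {..<4} \<longrightarrow>
        T $ i (p 0) $ i (p 1) $ i (p 2) $ i (p 3) = T $ i 0 $ i 1 $ i 2 $ i 3)"

definition tensor_form ::
  "'n::finite tensor4 \<Rightarrow> real ^ 'n \<Rightarrow> real ^ 'n \<Rightarrow> real ^ 'n \<Rightarrow> real ^ 'n \<Rightarrow> real" where
  "tensor_form T x y z w =
     (\<Sum>i\<in>UNIV. \<Sum>j\<in>UNIV. \<Sum>k\<in>UNIV. \<Sum>l\<in>UNIV. T $ i $ j $ k $ l * x $ i * y $ j * z $ k * w $ l)"

definition tensor_diag :: "'n::finite tensor4 \<Rightarrow> real ^ 'n \<Rightarrow> real" where
  "tensor_diag T x = tensor_form T x x x x"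

definition outer_prod :: "real ^ 'n::finite \<Rightarrow> real ^ 'n \<Rightarrow> real ^ 'n ^ 'n" where
  "outer_prod x y = (\<chi> i j. x $ i * y $ j)"

definition hs_inner :: "real ^ 'n::finite ^ 'n \<Rightarrow> real ^ 'n ^ 'n \<Rightarrow> real" where
  "hs_inner A B = trace (transpose A ** B)"

definition tensor_op :: "'n::finite tensor4 \<Rightarrow> real ^ 'n ^ 'n \<Rightarrow> real ^ 'n ^ 'n" where
  "tensor_op T A = (\<chi> i j. \<Sum>k\<in>UNIV. \<Sum>l\<in>UNIV. T $ i $ j $ k $ l * A $ k $ l)"

lemma hs_inner_eq_inner: "hs_inner A B = A \<bullet> B"
proof -
  have "hs_inner A B = (\<Sum>j\<in>UNIV. \<Sum>i\<in>UNIV. A $ i $ j * B $ i $ j)"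
    by (simp add: hs_inner_def trace_def transpose_def matrix_matrix_mult_def)
  also have "\<dots> = (\<Sum>i\<in>UNIV. \<Sum>j\<in>UNIV. A $ i $ j * B $ i $ j)"
    by (rule sum.swap)
  finally show ?thesis by (simp add: inner_vec_def)
qed

lemma tensor_form_eq_hs_inner:
  "tensor_form T x y z w = hs_inner (outer_prod x y) (tensor_op T (outer_prod z w))"
  by (simp add: tensor_form_def hs_inner_eq_inner inner_vec_def outer_prod_def tensor_op_def
      sum_distrib_left sum_distrib_right mult_ac)

text \<open>
  Positive definiteness of a tensor is meant in the non-strict sense.  The operator of a symmetric
  tensor annihilates every antisymmetric matrix (lemma \<open>tensor_op_antisymmetric\<close>), so for
  \<open>n \<ge> 2\<close> no symmetric tensor has a strictly positive definite \<open>n\<^sup>2 \<times> n\<^sup>2\<close> matrix.  The non-strict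
  condition covers both the strict one and strict positivity on symmetric matrices.
\<close>

definition pos_def_tensor :: "'n::finite tensor4 \<Rightarrow> bool" where
  "pos_def_tensor T \<longleftrightarrow>
     (\<forall>A B. hs_inner A (tensor_op T B) = hs_inner (tensor_op T A) B) \<and>
     (\<forall>A. 0 \<le> hs_inner A (tensor_op T A))"

lemma symmetric_tensor_swap34:
  assumes "symmetric_tensor T"
  shows "T $ a $ b $ c $ d = T $ a $ b $ d $ c"
proof -
  define i :: "nat \<Rightarrow> 'a" where "i = (\<lambda>m. if m = 0 then a else if m = 1 then b else if m = 2 then c else d)"
  have "Transposition.transpose 2 (3::nat) permutes {..<4}"
    by (rule permutes_swap_id) auto
  then have "T $ i 0 $ i 1 $ i 3 $ i 2 = T $ i 0 $ i 1 $ i 2 $ i 3"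
    using assms unfolding symmetric_tensor_def
    by (auto simp: Transposition.transpose_def dest!: spec[of _ "Transposition.transpose 2 3"])
  then show ?thesis by (simp add: i_def)
qed

lemma tensor_op_antisymmetric:
  assumes "symmetric_tensor T" and "transpose A = - A"
  shows "tensor_op T A = 0"
proof -
  have A: "A $ k $ l = - A $ l $ k" for k l
    using arg_cong[OF assms(2), of "\<lambda>M. M $ l $ k"] by (simp add: transpose_def)
  have "(\<Sum>k\<in>UNIV. \<Sum>l\<in>UNIV. T $ i $ j $ k $ l * A $ k $ l) = 0" (is "?s = 0") for i j
  proof -
    have "?s = (\<Sum>l\<in>UNIV. \<Sum>k\<in>UNIV. T $ i $ j $ k $ l * A $ k $ l)"
      by (rule sum.swap)
    also have "\<dots> = (\<Sum>l\<in>UNIV. \<Sum>k\<in>UNIV. - (T $ i $ j $ l $ k * A $ l $ k))"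
      by (intro sum.cong refl) (metis A mult_minus_right symmetric_tensor_swap34[OF assms(1)])
    also have "\<dots> = - ?s" by (simp add: sum_negf)
    finally show ?thesis by simp
  qed
  then show ?thesis by (simp add: tensor_op_def vec_eq_iff)
qed

definition inj_norm :: "'n::finite tensor4 \<Rightarrow> real" where
  "inj_norm T = Sup {\<bar>tensor_form T x y z w\<bar> | x y z w.
     norm x = 1 \<and> norm y = 1 \<and> norm z = 1 \<and> norm w = 1}"

definition cube :: "(real ^ 'n::finite) set" where
  "cube = {x. \<forall>i. x $ i \<in> {- 1, 1}}"

definition flip :: "'n::finite \<Rightarrow> real ^ 'n \<Rightarrow> real ^ 'n" where
  "flip i x = (\<chi> j. if j = i then - x $ j else x $ j)"

definition propto_on :: "'a set \<Rightarrow> ('a \<Rightarrow> real) \<Rightarrow> ('a \<Rightarrow> real) \<Rightarrow> bool" where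
  "propto_on S f g \<longleftrightarrow> (\<exists>c>0. \<forall>x\<in>S. f x = c * g x)"

definition dirichlet_form :: "(real ^ 'n::finite) pmf \<Rightarrow> (real ^ 'n \<Rightarrow> real) \<Rightarrow> real" where
  "dirichlet_form \<mu> \<phi> = 1 / 2 * (\<Sum>x\<in>cube. \<Sum>i\<in>UNIV.
     (\<phi> x - \<phi> (flip i x))\<^sup>2 * (pmf \<mu> x * pmf \<mu> (flip i x) / (pmf \<mu> x + pmf \<mu> (flip i x))))"

definition poincare_ineq :: "(real ^ 'n::finite) pmf \<Rightarrow> real \<Rightarrow> bool" where
  "poincare_ineq \<mu> C \<longleftrightarrow> (\<forall>\<phi>. measure_pmf.variance \<mu> \<phi> \<le> C * dirichlet_form \<mu> \<phi>)"

text \<open>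
  Intended for measures concentrated on \<open>cube\<close>.  The value is \<open>\<infinity>\<close> if there is no admissible
  constant; otherwise the infimum is attained (lemma \<open>poincare_constant_le_iff\<close>).
\<close>

definition poincare_constant :: "(real ^ 'n::finite) pmf \<Rightarrow> ereal" where
  "poincare_constant \<mu> = Inf {ereal C | C. 0 \<le> C \<and> poincare_ineq \<mu> C}"

lemma dirichlet_form_nonneg: "0 \<le> dirichlet_form \<mu> \<phi>"
  unfolding dirichlet_form_def by (intro mult_nonneg_nonneg sum_nonneg) auto

lemma poincare_constant_le_iff:
  assumes "0 \<le> C"
  shows "poincare_constant \<mu> \<le> ereal C \<longleftrightarrow> poincare_ineq \<mu> C"
proof
  assume "poincare_ineq \<mu> C"
  then show "poincare_constant \<mu> \<le> ereal C"
    unfolding poincare_constant_def using assms by (intro Inf_lower) auto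
next
  assume le: "poincare_constant \<mu> \<le> ereal C"
  have *: "poincare_ineq \<mu> D" if "C < D" for D
  proof -
    from le that have "poincare_constant \<mu> < ereal D"
      using le_less_trans by fastforce
    then obtain E where "poincare_ineq \<mu> E" "E < D"
      unfolding poincare_constant_def Inf_less_iff by auto
    then show ?thesis
      unfolding poincare_ineq_def
      by (meson dirichlet_form_nonneg less_imp_le mult_right_mono order_trans)
  qed
  show "poincare_ineq \<mu> C"
    unfolding poincare_ineq_def
  proof
    fix \<phi>
    have "((\<lambda>D. D * dirichlet_form \<mu> \<phi>) \<longlongrightarrow> C * dirichlet_form \<mu> \<phi>) (at_right C)"
      by (intro tendsto_intros)
    moreover have "\<forall>\<^sub>F D in at_right C. measure_pmf.variance \<mu> \<phi> \<le> D * dirichlet_form \<mu> \<phi>"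
      using * unfolding poincare_ineq_def
      by (auto simp: eventually_at_filter)
    ultimately show "measure_pmf.variance \<mu> \<phi> \<le> C * dirichlet_form \<mu> \<phi>"
      by (intro tendsto_lowerbound) auto
  qed
qed

text \<open>In \<open>ereal\<close>, a bound of the form \<open>1 / (1 - t)\<close> is the trivial bound \<open>\<infinity>\<close> at \<open>t = 1\<close>.\<close>

lemma one_divide_ereal_zero: "1 / ereal 0 = \<infinity>"
  by (simp add: divide_ereal_def)

end

theory Submission
  imports Defs
begin

text \<open>
  The proof is a discrete Bochner argument. Let \<open>Q\<^sub>i f\<close> be \<open>f\<close> minus its conditional expectation given
  all coordinates but the \<open>i\<close>-th, so that the Glauber generator is \<open>- (Q\<^sub>1 + \<dots> + Q\<^sub>n)\<close> and the Dirichlet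
  form is the sum of the \<open>|Q\<^sub>i f|\<^sup>2\<close>. The Poincare inequality follows once the sum over \<open>i \<noteq> j\<close> of the
  \<open>\<langle>Q\<^sub>i f, Q\<^sub>j f\<rangle>\<close> is at least \<open>- 56 n |T|\<close> times the Dirichlet form. On each two-dimensional face of the
  cube, \<open>\<langle>Q\<^sub>i f, Q\<^sub>j f\<rangle>\<close> is a nonnegative multiple of the squared mixed difference of \<open>f\<close> minus an error
  whose leading term is \<open>4 x\<^sub>i x\<^sub>j h\<^sub>i\<^sub>j(x)\<close> times \<open>r\<^sub>i Q\<^sub>i f\<close> and \<open>r\<^sub>j Q\<^sub>j f\<close>, where \<open>r\<^sub>i\<close> is the conditional
  probability of \<open>x\<^sub>i\<close> and \<open>h(x)\<close> the discrete Hessian of \<open>T\<close>; moreover \<open>|r\<^sub>i Q\<^sub>i f|\<^sup>2 \<le> |Q\<^sub>i f|\<^sup>2 / 4\<close>.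
  For positive \<open>T\<close> the quadratic form of \<open>h(x)\<close> is at most \<open>36 n |T|\<close> and its rows have Euclidean norm
  at most \<open>19 n |T|\<close>. The first bound controls the leading term, the second one the quadratic
  remainder, and \<open>36 + 3 \<sqdot> 19\<^sup>2 / 56 < 56\<close>.
\<close>

section \<open>Vectors and the cube\<close>

lemma cube_component_sq: "x \<in> cube \<Longrightarrow> (x $ i)\<^sup>2 = 1"
  by (auto simp: cube_def power2_eq_1_iff)

lemma abs_cube_component: "x \<in> cube \<Longrightarrow> \<bar>x $ i\<bar> = 1"
  by (auto simp: cube_def abs_eq_iff')

lemma power2_norm_eq_sum: "(norm (x :: real ^ 'n::finite))\<^sup>2 = (\<Sum>i\<in>UNIV. (x $ i)\<^sup>2)"
  by (simp add: norm_eq_sqrt_inner inner_vec_def power2_eq_square sum_nonneg)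

lemma sum_abs_le_sqrt:
  fixes v :: "real ^ 'n::finite"
  shows "(\<Sum>i\<in>S. \<bar>v $ i\<bar>) \<le> sqrt (card S) * norm v"
proof -
  have "(\<Sum>i\<in>S. \<bar>v $ i\<bar>)\<^sup>2 \<le> (\<Sum>i\<in>S. \<bar>v $ i\<bar>\<^sup>2) * (\<Sum>i\<in>S. 1\<^sup>2)"
    using Cauchy_Schwarz_ineq_sum[of "\<lambda>i. \<bar>v $ i\<bar>" "\<lambda>i. 1" S] by simp
  also have "\<dots> = (\<Sum>i\<in>S. (v $ i)\<^sup>2) * card S" by simp
  also have "\<dots> \<le> (norm v)\<^sup>2 * card S"
    unfolding power2_norm_eq_sum by (intro mult_right_mono sum_mono2) auto
  finally have "(\<Sum>i\<in>S. \<bar>v $ i\<bar>)\<^sup>2 \<le> (sqrt (card S) * norm v)\<^sup>2"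
    by (simp add: power_mult_distrib mult.commute)
  then show ?thesis by (rule power2_le_imp_le) simp
qed

section \<open>Positive quartic forms\<close>

text \<open>The form is kept as a function, so that multilinearity and symmetry act as rewrite rules
  and index sums stay out of sight. \<open>nonneg\<close> is positivity of the tensor operator at
  the rank-one matrix \<open>a \<otimes> b\<close>, with the two middle arguments exchanged;
  \<open>\<tau>\<close> plays the role of the injective norm.\<close>

locale quartic_form =
  fixes F :: "real ^ 'n::finite \<Rightarrow> real ^ 'n \<Rightarrow> real ^ 'n \<Rightarrow> real ^ 'n \<Rightarrow> real" and \<tau> :: real
  assumes add1: "F (a + a') b c d = F a b c d + F a' b c d"
    and scale1: "F (r *\<^sub>R a) b c d = r * F a b c d"
    and swap12: "F a b c d = F b a c d"
    and swap23: "F a b c d = F a c b d"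
    and swap34: "F a b c d = F a b d c"
    and abs_le: "\<bar>F a b c d\<bar> \<le> \<tau> * (norm a * norm b * norm c * norm d)"
    and nonneg: "0 \<le> F a a b b"
begin

abbreviation e :: "'n \<Rightarrow> real ^ 'n" where "e i \<equiv> axis i 1"

lemma add2: "F a (b + b') c d = F a b c d + F a b' c d"
  by (metis add1 swap12)

lemma add3: "F a b (c + c') d = F a b c d + F a b c' d"
  by (metis add2 swap23)

lemma add4: "F a b c (d + d') = F a b c d + F a b c d'"
  by (metis add3 swap34)

lemma scale2: "F a (r *\<^sub>R b) c d = r * F a b c d"
  by (metis scale1 swap12)

lemma scale3: "F a b (r *\<^sub>R c) d = r * F a b c d"
  by (metis scale2 swap23)

lemma scale4: "F a b c (r *\<^sub>R d) = r * F a b c d"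
  by (metis scale3 swap34)

lemma swap13: "F a b c d = F c b a d"
  by (metis swap12 swap23)

lemma swap24: "F a b c d = F a d c b"
  by (metis swap34 swap23)

lemma diff1: "F (a - a') b c d = F a b c d - F a' b c d"
  using add1[of "a - a'" a'] by simp

lemma diff2: "F a (b - b') c d = F a b c d - F a b' c d"
  using add2[of _ "b - b'" b'] by simp

lemma diff3: "F a b (c - c') d = F a b c d - F a b c' d"
  using add3[of _ _ "c - c'" c'] by simp

lemma diff4: "F a b c (d - d') = F a b c d - F a b c d'"
  using add4[of _ _ _ "d - d'" d'] by simp

lemmas multilinear = add1 add2 add3 add4 diff1 diff2 diff3 diff4 scale1 scale2 scale3 scale4

lemma expand4: "F a b c d = (\<Sum>j\<in>UNIV. d $ j * F a b c (e j))"
proof -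
  have "linear (F a b c)"
    by (rule linearI) (simp_all add: add4 scale4)
  then have "F a b c (\<Sum>j\<in>UNIV. d $ j *\<^sub>R e j) = (\<Sum>j\<in>UNIV. d $ j * F a b c (e j))"
    by (simp add: linear_sum scale4)
  then show ?thesis
    by (simp add: basis_expansion scalar_mult_eq_scaleR[symmetric])
qed

lemma tau_nonneg: "0 \<le> \<tau>"
  using abs_le[of "e undefined" "e undefined" "e undefined" "e undefined"] by simp

section \<open>Mixed values of a positive form and random signs\<close>

lemma polarization: "4 * F a b z z = F (a + b) (a + b) z z - F (a - b) (a - b) z z"
  by (simp add: multilinear swap12[of b a])

text \<open>By positivity both terms of the polarization identity are nonnegative, so their
  difference is bounded by the larger one and not by their sum. For orthogonal \<open>a\<close> and
  \<open>b\<close> this halves the bound given by the norms.\<close>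

lemma abs_mixed_le_unit:
  assumes "norm a = 1" "norm b = 1"
  shows "\<bar>F a b z z\<bar> \<le> \<tau> * ((1 + \<bar>a \<bullet> b\<bar>) / 2) * (norm z)\<^sup>2"
proof -
  have ab: "(norm (a + b))\<^sup>2 = 2 + 2 * (a \<bullet> b)" "(norm (a - b))\<^sup>2 = 2 - 2 * (a \<bullet> b)"
    using assms by (simp_all add: power2_norm_eq_inner inner_simps inner_commute norm_eq_1)
  have up: "F c c z z \<le> \<tau> * ((norm c)\<^sup>2 * (norm z)\<^sup>2)" for c
    using abs_le[of c c z z] by (simp add: power2_eq_square mult_ac)
  have b1: "F (a + b) (a + b) z z \<le> \<tau> * ((2 + 2 * \<bar>a \<bullet> b\<bar>) * (norm z)\<^sup>2)"
    by (rule order_trans[OF up], unfold ab) (intro mult_left_mono mult_right_mono tau_nonneg; simp)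
  have b2: "F (a - b) (a - b) z z \<le> \<tau> * ((2 + 2 * \<bar>a \<bullet> b\<bar>) * (norm z)\<^sup>2)"
    by (rule order_trans[OF up], unfold ab) (intro mult_left_mono mult_right_mono tau_nonneg; simp)
  show ?thesis
    using b1 b2 polarization[of a b z] nonneg[of "a + b" z] nonneg[of "a - b" z]
    by (simp add: field_simps)
qed

lemma abs_mixed_le:
  "\<bar>F a b z z\<bar> \<le> \<tau> * ((norm a * norm b + \<bar>a \<bullet> b\<bar>) / 2) * (norm z)\<^sup>2"
proof (cases "a = 0 \<or> b = 0")
  case True
  then show ?thesis using scale1[of 0 0] scale2[of _ 0 0] by auto
next
  case False
  define a' b' where "a' = sgn a" and "b' = sgn b"
  have n: "norm a' = 1" "norm b' = 1" using False by (auto simp: a'_def b'_def norm_sgn)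
  have ab: "a = norm a *\<^sub>R a'" "b = norm b *\<^sub>R b'" using False by (auto simp: a'_def b'_def sgn_div_norm)
  have "F a b z z = norm a * norm b * F a' b' z z"
    by (subst ab(1), subst ab(2)) (simp add: scale1 scale2)
  then have "\<bar>F a b z z\<bar> = norm a * norm b * \<bar>F a' b' z z\<bar>"
    by (simp add: abs_mult)
  also have "\<dots> \<le> norm a * norm b * (\<tau> * ((1 + \<bar>a' \<bullet> b'\<bar>) / 2) * (norm z)\<^sup>2)"
    by (intro mult_left_mono abs_mixed_le_unit n) auto
  also have "\<dots> = \<tau> * ((norm a * norm b + norm a * norm b * \<bar>a' \<bullet> b'\<bar>) / 2) * (norm z)\<^sup>2"
    by (simp add: field_simps)
  also have "norm a * norm b * \<bar>a' \<bullet> b'\<bar> = \<bar>a \<bullet> b\<bar>"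
    by (subst (2) ab(1), subst (2) ab(2)) (simp add: abs_mult)
  finally show ?thesis .
qed

lemma abs_mixed_le_orthogonal:
  assumes "a \<bullet> b = 0"
  shows "\<bar>F a b z z\<bar> \<le> \<tau> / 2 * (norm a * norm b * (norm z)\<^sup>2)"
  using abs_mixed_le[of a b z] assms by (simp add: field_simps)

text \<open>Averaging over independent random signs of the coordinates in \<open>S\<close>, one coordinate at a time.\<close>

lemma sign_average:
  assumes "finite S"
  shows "F p p p p + 6 * (\<Sum>i\<in>S. (t i)\<^sup>2 * F p p (e i) (e i))
      + 3 * (\<Sum>i\<in>S. \<Sum>j\<in>S. (t i)\<^sup>2 * (t j)\<^sup>2 * F (e i) (e i) (e j) (e j))
      - 2 * (\<Sum>i\<in>S. (t i) ^ 4 * F (e i) (e i) (e i) (e i))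
    \<le> \<tau> * (((norm p)\<^sup>2 + (\<Sum>i\<in>S. (t i)\<^sup>2))\<^sup>2 + 4 * (\<Sum>i\<in>S. (p $ i)\<^sup>2 * (t i)\<^sup>2))"
  using assms
proof (induction S arbitrary: p rule: finite_induct)
  case empty
  show ?case using abs_le[of p p p p] by (simp add: power2_eq_square mult_ac)
next
  case (insert k S)
  define z where "z = t k *\<^sub>R e k"
  let ?A = "\<lambda>p. \<Sum>i\<in>S. (t i)\<^sup>2 * F p p (e i) (e i)"
  let ?B = "\<Sum>i\<in>S. \<Sum>j\<in>S. (t i)\<^sup>2 * (t j)\<^sup>2 * F (e i) (e i) (e j) (e j)"
  let ?C = "\<Sum>i\<in>S. (t i) ^ 4 * F (e i) (e i) (e i) (e i)"
  let ?d = "\<Sum>i\<in>S. (t i)\<^sup>2"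
  let ?R = "\<lambda>p. \<Sum>i\<in>S. (p $ i)\<^sup>2 * (t i)\<^sup>2"
  have q: "F (p + z) (p + z) (p + z) (p + z) + F (p - z) (p - z) (p - z) (p - z)
      = 2 * F p p p p + 12 * ((t k)\<^sup>2 * F p p (e k) (e k)) + 2 * ((t k) ^ 4 * F (e k) (e k) (e k) (e k))"
    unfolding z_def
    by (simp add: multilinear swap12[of "e k" p] swap23[of _ "e k" p] swap34[of _ _ "e k" p]
        power2_eq_square power4_eq_xxxx algebra_simps)
  have a: "?A (p + z) + ?A (p - z) = 2 * ?A p + 2 * ((t k)\<^sup>2 * (\<Sum>i\<in>S. (t i)\<^sup>2 * F (e k) (e k) (e i) (e i)))"
    unfolding z_def
    by (simp add: multilinear swap12[of "e k" p] sum_distrib_left sum.distrib[symmetric] 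
         power2_eq_square algebra_simps)
  have b: "(\<Sum>i\<in>S. (t i)\<^sup>2 * ((t k)\<^sup>2 * F (e i) (e i) (e k) (e k)))
      = (t k)\<^sup>2 * (\<Sum>i\<in>S. (t i)\<^sup>2 * F (e k) (e k) (e i) (e i))"
    unfolding sum_distrib_left
    by (intro sum.cong refl) (metis (no_types, lifting) mult.left_commute swap13 swap24)
  have zk: "z $ i = (if i = k then t k else 0)" for i by (simp add: z_def axis_def)
  have r: "?R (p + z) = ?R p" "?R (p - z) = ?R p"
    using insert.hyps by (auto intro!: sum.cong simp: zk)
  have pz: "p \<bullet> z = t k * p $ k" "z \<bullet> z = (t k)\<^sup>2"
    by (simp_all add: z_def inner_axis power2_eq_square)
  have nrm: "(norm (p + z))\<^sup>2 = (norm p)\<^sup>2 + 2 * (t k * p $ k) + (t k)\<^sup>2"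
       "(norm (p - z))\<^sup>2 = (norm p)\<^sup>2 - 2 * (t k * p $ k) + (t k)\<^sup>2"
    using pz by (simp_all add: power2_norm_eq_inner inner_simps inner_commute)
  have sq: "((norm (p + z))\<^sup>2 + ?d)\<^sup>2 + ((norm (p - z))\<^sup>2 + ?d)\<^sup>2
      = 2 * ((norm p)\<^sup>2 + ((t k)\<^sup>2 + ?d))\<^sup>2 + 8 * ((p $ k)\<^sup>2 * (t k)\<^sup>2)"
    unfolding nrm by (simp add: power2_eq_square algebra_simps)
  define L where "L = (\<lambda>p. F p p p p + 6 * ?A p + 3 * ?B - 2 * ?C)"
  define U where "U = (\<lambda>p. \<tau> * (((norm p)\<^sup>2 + ?d)\<^sup>2 + 4 * ?R p))"
  have IH: "L p \<le> U p" for p unfolding L_def U_def by (rule insert.IH)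
  have LS: "L (p + z) + L (p - z) = 2 * (F p p p p + 6 * ((t k)\<^sup>2 * F p p (e k) (e k) + ?A p)
      + 3 * ((t k) ^ 4 * F (e k) (e k) (e k) (e k)
             + 2 * ((t k)\<^sup>2 * (\<Sum>i\<in>S. (t i)\<^sup>2 * F (e k) (e k) (e i) (e i))) + ?B)
      - 2 * ((t k) ^ 4 * F (e k) (e k) (e k) (e k) + ?C))"
    unfolding L_def using q a by (simp add: algebra_simps)
  have US: "U (p + z) + U (p - z) = 2 * (\<tau> * (((norm p)\<^sup>2 + ((t k)\<^sup>2 + ?d))\<^sup>2 
      + 4 * ((p $ k)\<^sup>2 * (t k)\<^sup>2 + ?R p)))"
    unfolding U_def r distrib_left[symmetric] using sq by (simp add: algebra_simps)
  \<comment> \<open>The diagonal entry at \<open>k\<close> comes with the factor 3 of this sum and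
    the factor -2 of the last one; the remaining 1 is the fourth moment of a single sign, as in
    \<open>q\<close>.\<close>
  have BB: "(\<Sum>i\<in>insert k S. \<Sum>j\<in>insert k S. (t i)\<^sup>2 * (t j)\<^sup>2 * F (e i) (e i) (e j) (e j))
     = (t k) ^ 4 * F (e k) (e k) (e k) (e k)
             + 2 * ((t k)\<^sup>2 * (\<Sum>i\<in>S. (t i)\<^sup>2 * F (e k) (e k) (e i) (e i))) + ?B"
    using insert.hyps b 
    by (simp add: sum.distrib sum_distrib_left power2_eq_square power4_eq_xxxx mult.assoc)
  show ?case
    unfolding BB using insert.hyps IH[of "p + z"] IH[of "p - z"] LS US by simp
qed

section \<open>The discrete Hessian of the quartic\<close>

text \<open>For \<open>i \<noteq> j\<close> this is the coefficient of \<open>x\<^sub>i x\<^sub>j\<close> in the multilinear representation on the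
  cube of the quartic \<open>F x x x x\<close>, as a function of the other coordinates of \<open>x\<close>.\<close>

definition hess :: "real ^ 'n \<Rightarrow> 'n \<Rightarrow> 'n \<Rightarrow> real" where
  "hess x i j = (let y = x - x $ i *\<^sub>R e i - x $ j *\<^sub>R e j in
     12 * F (e i) (e j) y y + 4 * F (e i) (e i) (e i) (e j) + 4 * F (e i) (e j) (e j) (e j))"

lemma hess_sym: "hess x i j = hess x j i"
proof -
  have "F (e i) (e i) (e i) (e j) = F (e j) (e i) (e i) (e i)" by (metis swap13 swap34)
  moreover have "F (e i) (e j) (e j) (e j) = F (e j) (e j) (e j) (e i)" by (metis swap13 swap34)
  ultimately show ?thesis
    unfolding hess_def Let_def by (simp add: swap12[of "e i" "e j"] algebra_simps)
qed

text \<open>Only the monomials odd in both \<open>v\<close> and \<open>w\<close> survive, and 12, 4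
  and 4 are their multinomial coefficients. Since \<open>a\<close> and \<open>b\<close> are signs,
  their cubes reduce to \<open>a\<close> and \<open>b\<close>.\<close>

lemma second_difference:
  assumes "a\<^sup>2 = 1" "b\<^sup>2 = 1"
  defines "V \<equiv> \<lambda>x. F x x x x"
  shows "V (y + a *\<^sub>R v + b *\<^sub>R w) - V (y - a *\<^sub>R v + b *\<^sub>R w)
      - V (y + a *\<^sub>R v - b *\<^sub>R w) + V (y - a *\<^sub>R v - b *\<^sub>R w)
    = 4 * a * b * (12 * F v w y y + 4 * F v v v w + 4 * F v w w w)"
proof -
  have D: "V (z + b *\<^sub>R w) - V (z - b *\<^sub>R w) = 8 * b * F z z z w + 8 * b ^ 3 * F z w w w" for z
    unfolding V_def
    by (simp add: multilinear swap12[of w z] swap23[of _ w z] swap34[of _ _ w z]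
        power3_eq_cube algebra_simps)
  have C: "F (y + a *\<^sub>R v) (y + a *\<^sub>R v) (y + a *\<^sub>R v) w - F (y - a *\<^sub>R v) (y - a *\<^sub>R v) (y - a *\<^sub>R v) w
      = 6 * a * F v w y y + 2 * a ^ 3 * F v v v w"
    by (simp add: multilinear swap12[of y v] swap23[of _ y v] swap34[of _ _ y w] swap23[of _ y w]
        power3_eq_cube algebra_simps)
  have B: "F (y + a *\<^sub>R v) w w w - F (y - a *\<^sub>R v) w w w = 2 * a * F v w w w"
    by (simp add: multilinear)
  have ab: "a ^ 3 = a" "b ^ 3 = b"
    using assms by (simp_all add: power3_eq_cube power2_eq_square)
  have "V (y + a *\<^sub>R v + b *\<^sub>R w) - V (y - a *\<^sub>R v + b *\<^sub>R w)
      - V (y + a *\<^sub>R v - b *\<^sub>R w) + V (y - a *\<^sub>R v - b *\<^sub>R w)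
    = 8 * b * (F (y + a *\<^sub>R v) (y + a *\<^sub>R v) (y + a *\<^sub>R v) w - F (y - a *\<^sub>R v) (y - a *\<^sub>R v) (y - a *\<^sub>R v) w)
      + 8 * b * (F (y + a *\<^sub>R v) w w w - F (y - a *\<^sub>R v) w w w)"
    using D[of "y + a *\<^sub>R v"] D[of "y - a *\<^sub>R v"] unfolding ab by (simp add: algebra_simps)
  also have "\<dots> = 4 * a * b * (12 * F v w y y + 4 * F v v v w + 4 * F v w w w)"
    unfolding C B ab by (simp add: algebra_simps)
  finally show ?thesis .
qed

text \<open>This identifies \<open>hess\<close> as the pair interaction: exponentiated, it is the
  cross ratio of the Gibbs weights on a two-dimensional face of the cube.\<close>

lemma flip_second_difference:
  assumes "x \<in> cube" "i \<noteq> j"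
  defines "V \<equiv> \<lambda>x. F x x x x"
  shows "V x - V (flip i x) - V (flip j x) + V (flip i (flip j x)) = 4 * x $ i * x $ j * hess x i j"
proof -
  define y where "y = x - x $ i *\<^sub>R e i - x $ j *\<^sub>R e j"
  have 1: "x = y + x $ i *\<^sub>R e i + x $ j *\<^sub>R e j" by (simp add: y_def)
  have 2: "flip i x = y - x $ i *\<^sub>R e i + x $ j *\<^sub>R e j"
     "flip j x = y + x $ i *\<^sub>R e i - x $ j *\<^sub>R e j"
     "flip i (flip j x) = y - x $ i *\<^sub>R e i - x $ j *\<^sub>R e j"
    using assms(2) by (auto simp: y_def flip_def vec_eq_iff axis_def)
  have "V x = V (y + x $ i *\<^sub>R e i + x $ j *\<^sub>R e j)" using 1 by simp
  then show ?thesis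
    unfolding 2(3) unfolding 2(1,2) hess_def Let_def y_def[symmetric]
    using second_difference[of "x $ i" "x $ j" y "e i" "e j"] cube_component_sq[OF assms(1)]
    unfolding V_def by simp
qed

section \<open>Entrywise, row and quadratic-form bounds for the Hessian\<close>

lemma e_orthogonal: "i \<noteq> j \<Longrightarrow> e i \<bullet> e j = 0"
  by (simp add: inner_axis_axis)

text \<open>Orthogonality of \<open>e i\<close> and \<open>e j\<close> halves each of the three
  bounds, and the vector with both coordinates removed has squared norm \<open>n - 2\<close>: the
  total is \<open>6 (n - 2) + 2 + 2\<close>, times \<open>\<tau>\<close>.\<close>

lemma abs_hess_le:
  assumes "x \<in> cube" "i \<noteq> j"
  shows "\<bar>hess x i j\<bar> \<le> 6 * (real CARD('n) * \<tau>)"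
proof -
  define y where "y = x - x $ i *\<^sub>R e i - x $ j *\<^sub>R e j"
  have "(norm y)\<^sup>2 = (\<Sum>k\<in>UNIV. if k \<in> {i, j} then 0 else 1)"
    unfolding power2_norm_eq_sum
    by (intro sum.cong) (use assms in \<open>auto simp: y_def axis_def cube_component_sq\<close>)
  also have "\<dots> = (\<Sum>k\<in>UNIV - {i, j}. 1)"
    by (rule sum.mono_neutral_cong_right) auto
  also have "\<dots> = real CARD('n) - 2"
    using assms(2) card_mono[of UNIV "{i, j}"] by (simp add: card_Diff_subset of_nat_diff)
  finally have y: "(norm y)\<^sup>2 = real CARD('n) - 2" .
  have "\<bar>F (e i) (e j) y y\<bar> \<le> \<tau> / 2 * (real CARD('n) - 2)"
    using abs_mixed_le_orthogonal[OF e_orthogonal[OF assms(2)], of y] y by simp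
  moreover have "\<bar>F (e i) (e i) (e i) (e j)\<bar> \<le> \<tau> / 2"
    using abs_mixed_le_orthogonal[OF e_orthogonal[OF assms(2)], of "e i"]
    by (metis mult.right_neutral norm_axis_1 power_one swap13 swap24)
  moreover have "\<bar>F (e i) (e j) (e j) (e j)\<bar> \<le> \<tau> / 2"
    using abs_mixed_le_orthogonal[OF e_orthogonal[OF assms(2)], of "e j"] by simp
  ultimately show ?thesis
    unfolding hess_def Let_def y_def[symmetric] using tau_nonneg by (simp add: algebra_simps)
qed

text \<open>Duality: the row \<open>v\<close>, tested against itself, gives \<open>|v|^2\<close> as
  a sum of values of the form at \<open>v\<close>. As \<open>v\<close> is orthogonal to
  \<open>e i\<close>, the halved bounds apply, and dividing by \<open>|v|\<close> leaves a bound on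
  the norm.\<close>

lemma hess_row_le:
  assumes "x \<in> cube"
  shows "(\<Sum>j\<in>UNIV - {i}. (hess x i j)\<^sup>2) \<le> (19 * (real CARD('n) * \<tau>))\<^sup>2"
proof -
  let ?n = "real CARD('n)"
  define v :: "real ^ 'n" where "v = (\<chi> j. if j = i then 0 else hess x i j)"
  define z where "z = x - x $ i *\<^sub>R e i"
  have vi: "v $ i = 0" by (simp add: v_def)
  have n1: "real (card (UNIV - {i})) = ?n - 1"
    by (simp add: card_Diff_singleton of_nat_diff)
  have n1': "1 \<le> ?n" by (simp add: Suc_leI)
  have z2: "(norm z)\<^sup>2 = ?n - 1"
  proof -
    have "(norm z)\<^sup>2 = (\<Sum>k\<in>UNIV - {i}. 1)"
      unfolding power2_norm_eq_sum
      by (rule sum.mono_neutral_cong_right) (use assms in \<open>auto simp: z_def axis_def cube_component_sq\<close>)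
    then show ?thesis using n1 by simp
  qed
  have orth: "e i \<bullet> z = 0" "e i \<bullet> v = 0"
    by (simp_all add: z_def inner_axis inner_axis' vi inner_diff_right)
  \<comment> \<open>Recentred at \<open>z\<close>, which, unlike the point in \<open>hess\<close>,
    does not depend on \<open>j\<close>, so that the first term is linear in
    \<open>e j\<close>.\<close>
  have h: "hess x i j = 12 * F (e i) (e j) z z - 24 * x $ j * F (e i) z (e j) (e j)
      + 16 * F (e i) (e j) (e j) (e j) + 4 * F (e i) (e i) (e i) (e j)" for j
  proof -
    have "hess x i j = 12 * F (e i) (e j) (z - x $ j *\<^sub>R e j) (z - x $ j *\<^sub>R e j)
       + 4 * F (e i) (e i) (e i) (e j) + 4 * F (e i) (e j) (e j) (e j)"
      by (simp add: hess_def Let_def z_def)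
    also have "\<dots> = 12 * F (e i) (e j) z z - 24 * x $ j * F (e i) z (e j) (e j)
      + (12 * (x $ j)\<^sup>2 + 4) * F (e i) (e j) (e j) (e j) + 4 * F (e i) (e i) (e i) (e j)"
      by (simp add: multilinear swap23[of _ "e j" z] swap34[of _ _ "e j" z] 
         power2_eq_square algebra_simps)
    finally show ?thesis using assms by (simp add: cube_component_sq)
  qed
  have "(norm v)\<^sup>2 = (\<Sum>j\<in>UNIV. v $ j * hess x i j)"
    unfolding power2_norm_eq_sum by (intro sum.cong) (auto simp: v_def power2_eq_square)
  also have "\<dots> = 12 * F (e i) v z z - 24 * (\<Sum>j\<in>UNIV. v $ j * x $ j * F (e i) z (e j) (e j))
      + 16 * (\<Sum>j\<in>UNIV. v $ j * F (e i) (e j) (e j) (e j)) + 4 * F (e i) (e i) (e i) v"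
  proof -
    have a: "F (e i) v z z = (\<Sum>j\<in>UNIV. v $ j * F (e i) (e j) z z)"
      using expand4[of "e i" z z v] by (simp add: swap24[of _ z])
    show ?thesis unfolding h a expand4[of "e i" "e i" "e i" v] sum_distrib_left
      by (simp add: sum.distrib[symmetric] sum_subtractf[symmetric] algebra_simps)
  qed
  finally have eq: "(norm v)\<^sup>2 = \<dots>" .
  have 1: "\<bar>F (e i) v z z\<bar> \<le> \<tau> / 2 * (norm v * (?n - 1))"
    using abs_mixed_le_orthogonal[OF orth(2), of z] z2 by simp
  have 2: "\<bar>F (e i) (e i) (e i) v\<bar> \<le> \<tau> / 2 * norm v"
    using abs_mixed_le_orthogonal[OF orth(2), of "e i"]
    by (metis mult.right_neutral mult_1 norm_axis_1 power_one swap13 swap24)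
  have sv: "(\<Sum>j\<in>UNIV. \<bar>v $ j\<bar>) \<le> sqrt (?n - 1) * norm v"
  proof -
    have "(\<Sum>j\<in>UNIV. \<bar>v $ j\<bar>) = (\<Sum>j\<in>UNIV - {i}. \<bar>v $ j\<bar>)"
      by (rule sum.mono_neutral_right) (auto simp: vi)
    then show ?thesis using sum_abs_le_sqrt[of v "UNIV - {i}"] n1 by simp
  qed
  have weighted: "\<bar>\<Sum>j\<in>UNIV. v $ j * g j\<bar> \<le> sqrt (?n - 1) * norm v * c"
    if "\<And>j. j \<noteq> i \<Longrightarrow> \<bar>g j\<bar> \<le> c" "0 \<le> c" for g c
  proof -
    have "\<bar>\<Sum>j\<in>UNIV. v $ j * g j\<bar> \<le> (\<Sum>j\<in>UNIV. \<bar>v $ j\<bar> * c)"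
      by (rule order_trans[OF sum_abs], rule sum_mono)
        (metis abs_ge_zero abs_mult abs_zero mult_left_mono mult_zero_left order_refl that(1) vi)
    also have "\<dots> \<le> sqrt (?n - 1) * norm v * c"
      unfolding sum_distrib_right[symmetric] by (intro mult_right_mono sv that)
    finally show ?thesis .
  qed
  have nz: "norm z = sqrt (?n - 1)" using z2 by (metis norm_ge_zero real_sqrt_unique)
  have 3: "\<bar>\<Sum>j\<in>UNIV. v $ j * (x $ j * F (e i) z (e j) (e j))\<bar> \<le> sqrt (?n - 1) * norm v * (\<tau> / 2 * sqrt (?n - 1))"
  proof (rule weighted)
    fix j
    show "\<bar>x $ j * F (e i) z (e j) (e j)\<bar> \<le> \<tau> / 2 * sqrt (?n - 1)"
      using abs_mixed_le_orthogonal[OF orth(1), of "e j"] nz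
      by (simp add: abs_mult abs_cube_component[OF assms])
  qed (use tau_nonneg n1' in simp)
  have 4: "\<bar>\<Sum>j\<in>UNIV. v $ j * F (e i) (e j) (e j) (e j)\<bar> \<le> sqrt (?n - 1) * norm v * (\<tau> / 2)"
  proof (rule weighted)
    fix j assume "j \<noteq> i"
    then show "\<bar>F (e i) (e j) (e j) (e j)\<bar> \<le> \<tau> / 2"
      using abs_mixed_le_orthogonal[OF e_orthogonal[of i j], of "e j"] by simp
  qed (use tau_nonneg in simp)
  define r where "r = sqrt (?n - 1)"
  have r2: "r * r = ?n - 1" using n1' by (simp add: r_def)
  have "(norm v)\<^sup>2 \<le> 6 * (\<tau> * norm v * (?n - 1)) + 12 * (\<tau> * norm v * (r * r)) + 8 * (\<tau> * norm v * r) + 2 * (\<tau> * norm v)"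
    unfolding eq using 1 2 3 4 unfolding r_def[symmetric] by (simp add: algebra_simps)
  also have "\<dots> = \<tau> * norm v * (18 * (r * r) + 8 * r + 2)"
    unfolding r2[symmetric] by (simp add: algebra_simps)
  also have "\<dots> \<le> \<tau> * norm v * (19 * ?n)"
  proof (rule mult_left_mono)
    \<comment> \<open>Equivalent to \<open>8 r \<le> r^2 + 16\<close>, which absorbs the square-root
      term into one more multiple of \<open>n\<close>.\<close>
    have "0 \<le> (r - 4)\<^sup>2" by simp
    then show "18 * (r * r) + 8 * r + 2 \<le> 19 * ?n"
      using r2 by (simp add: power2_eq_square algebra_simps)
  qed (use tau_nonneg in simp)
  finally have "norm v * norm v \<le> norm v * (19 * (?n * \<tau>))" 
    by (simp add: power2_eq_square mult_ac)
  then have "norm v \<le> 19 * (?n * \<tau>)"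
    using tau_nonneg by (cases "norm v = 0") (auto simp: mult_le_cancel_left)
  then have "(norm v)\<^sup>2 \<le> (19 * (?n * \<tau>))\<^sup>2" by (intro power_mono) auto
  moreover have "(norm v)\<^sup>2 = (\<Sum>j\<in>UNIV - {i}. (hess x i j)\<^sup>2)"
    unfolding power2_norm_eq_sum
    by (rule sum.mono_neutral_cong_right) (auto simp: v_def)
  ultimately show ?thesis by simp
qed

text \<open>In low dimension the entrywise bound suffices: the off-diagonal part of the square of
  the sum of the \<open>|u i|\<close> is at most \<open>n - 1 \<le> 6\<close> times
  \<open>|u|^2\<close>, and \<open>6 * 6 = 36\<close>.\<close>

lemma hess_quadratic_le_small:
  assumes "x \<in> cube" "CARD('n) \<le> 7"
  shows "(\<Sum>i\<in>UNIV. \<Sum>j\<in>UNIV - {i}. u $ i * u $ j * hess x i j) \<le> 36 * (real CARD('n) * \<tau>) * (norm u)\<^sup>2"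
proof -
  let ?c = "6 * (real CARD('n) * \<tau>)"
  let ?S = "\<Sum>i\<in>UNIV. \<bar>u $ i\<bar>"
  have "(\<Sum>i\<in>UNIV. \<Sum>j\<in>UNIV - {i}. u $ i * u $ j * hess x i j)
     \<le> (\<Sum>i\<in>UNIV. \<Sum>j\<in>UNIV - {i}. \<bar>u $ i\<bar> * \<bar>u $ j\<bar> * ?c)"
  proof (intro sum_mono)
    fix i j :: 'n assume "j \<in> UNIV - {i}"
    then have "\<bar>u $ i * u $ j * hess x i j\<bar> \<le> \<bar>u $ i\<bar> * \<bar>u $ j\<bar> * ?c"
      unfolding abs_mult by (intro mult_left_mono abs_hess_le assms) auto
    then show "u $ i * u $ j * hess x i j \<le> \<bar>u $ i\<bar> * \<bar>u $ j\<bar> * ?c" by linarith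
  qed
  also have "\<dots> = (\<Sum>i\<in>UNIV. \<bar>u $ i\<bar> * (?S - \<bar>u $ i\<bar>) * ?c)"
    by (intro sum.cong refl)
      (simp add: sum_diff1 flip: sum_distrib_left sum_distrib_right del: mult_cancel_right)
  also have "\<dots> = (\<Sum>i\<in>UNIV. \<bar>u $ i\<bar> * (?S - \<bar>u $ i\<bar>)) * ?c"
    by (rule sum_distrib_right[symmetric])
  also have "(\<Sum>i\<in>UNIV. \<bar>u $ i\<bar> * (?S - \<bar>u $ i\<bar>)) = ?S\<^sup>2 - (norm u)\<^sup>2"
    by (simp add: right_diff_distrib sum_subtractf power2_norm_eq_sum
        flip: sum_distrib_right power2_eq_square)
  also have "(?S\<^sup>2 - (norm u)\<^sup>2) * ?c \<le> (6 * (norm u)\<^sup>2) * ?c"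
  proof (rule mult_right_mono)
    have "?S \<le> sqrt 7 * norm u"
      by (rule order_trans[OF sum_abs_le_sqrt]) (use assms(2) in \<open>auto intro!: mult_right_mono\<close>)
    then have "?S\<^sup>2 \<le> (sqrt 7 * norm u)\<^sup>2" by (intro power_mono) (auto simp: sum_nonneg)
    then show "?S\<^sup>2 - (norm u)\<^sup>2 \<le> 6 * (norm u)\<^sup>2" by (simp add: power_mult_distrib)
  qed (use tau_nonneg in simp)
  finally show ?thesis by (simp add: mult_ac)
qed

text \<open>The left-hand side is \<open>24 |u \<otimes> x - D|\<^sup>2 - 12 |u \<otimes> x|\<^sup>2\<close> in the seminorm of the tensor, with \<open>D\<close>
  the diagonal part of \<open>u \<otimes> x\<close>. With \<open>p = (u + x) / 2\<close> and \<open>m = (u - x) / 2\<close> the symmetric part of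
  \<open>u \<otimes> x - D\<close> is \<open>P - N\<close> for the positive matrices \<open>P = p \<otimes> p + diag (m\<^sub>i\<^sup>2)\<close> and
  \<open>N = m \<otimes> m + diag (p\<^sub>i\<^sup>2)\<close> of trace 1, whose seminorms random signs control.\<close>

lemma offdiagonal_seminorm_le:
  assumes "norm u = 1" "norm x = 1" and x4: "\<And>i. (x $ i)\<^sup>2 = s"
  shows "12 * F u u x x - 48 * (\<Sum>i\<in>UNIV. u $ i * x $ i * F (e i) (e i) u x)
      + 24 * (\<Sum>i\<in>UNIV. \<Sum>j\<in>UNIV. (u $ i * x $ i) * (u $ j * x $ j) * F (e i) (e i) (e j) (e j))
    \<le> \<tau> * (26 + 18 * s)"
proof -
  define p m where "p = (1/2) *\<^sub>R (u + x)" and "m = (1/2) *\<^sub>R (u - x)"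
  have ux: "u = p + m" "x = p - m" by (simp_all add: p_def m_def algebra_simps flip: scaleR_add_left)
  define d f where "d = (\<lambda>i. (m $ i)\<^sup>2)" and "f = (\<lambda>i. (p $ i)\<^sup>2)"
  define X where "X = (\<lambda>g h. \<Sum>i\<in>UNIV. \<Sum>j\<in>UNIV. g i * h j * F (e i) (e i) (e j) (e j))"
  define Y where "Y = (\<lambda>v g. \<Sum>i\<in>UNIV. g i * F v v (e i) (e i))"
  have d0: "0 \<le> d i" "0 \<le> f i" for i by (simp_all add: d_def f_def)
  have w: "u $ i * x $ i = f i - d i" for i
    by (simp add: ux d_def f_def power2_eq_square algebra_simps)
  have F1: "F u u x x = F p p p p + F m m m m - 2 * F p p m m"
  proof -
    have "F u x u x = F p p p p + F m m m m - 2 * F p p m m"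
      unfolding ux using swap13[of m m p p] swap24[of p m m p]
      by (simp add: multilinear swap12[of m p] swap34[of _ _ m p] algebra_simps)
    then show ?thesis by (metis swap23)
  qed
  have F2: "F (e i) (e i) u x = F p p (e i) (e i) - F m m (e i) (e i)" for i
  proof -
    have "F u x (e i) (e i) = F p p (e i) (e i) - F m m (e i) (e i)"
      unfolding ux by (simp add: multilinear swap12[of m p])
    then show ?thesis by (metis swap13 swap24)
  qed
  have Ypos: "0 \<le> Y v g" if "\<And>i. 0 \<le> g i" for v g
    unfolding Y_def by (intro sum_nonneg mult_nonneg_nonneg that nonneg)
  have Xpos: "0 \<le> X g h" if "\<And>i. 0 \<le> g i" "\<And>i. 0 \<le> h i" for h g
    unfolding X_def by (intro sum_nonneg mult_nonneg_nonneg that nonneg)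
  have Xsym: "X g h = X h g" for g h
    unfolding X_def by (subst sum.swap) (intro sum.cong refl, metis mult.commute swap13 swap24)
  have S2: "(\<Sum>i\<in>UNIV. u $ i * x $ i * F (e i) (e i) u x)
      = Y p f - Y p d - Y m f + Y m d"
    unfolding w F2 Y_def by (simp add: sum_subtractf sum.distrib algebra_simps)
  have S3: "(\<Sum>i\<in>UNIV. \<Sum>j\<in>UNIV. (u $ i * x $ i) * (u $ j * x $ j) * F (e i) (e i) (e j) (e j))
      = X f f - X f d - X d f + X d d"
    unfolding w X_def by (simp add: sum_subtractf sum.distrib algebra_simps)
  have up: "\<bar>F v v v v\<bar> \<le> \<tau> * ((norm v)\<^sup>2)\<^sup>2" for v
    using abs_le[of v v v v] by (simp add: power2_eq_square mult_ac)
  have nrm: "(norm p)\<^sup>2 = (1 + u \<bullet> x) / 2" "(norm m)\<^sup>2 = (1 - u \<bullet> x) / 2"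
    using assms(1,2) unfolding p_def m_def
    by (simp_all add: power2_norm_eq_inner inner_simps inner_commute norm_eq_1 del: norm_scaleR)
  have tr: "(norm p)\<^sup>2 + (norm m)\<^sup>2 = 1" unfolding nrm by (simp add: field_simps)
  have sums: "(\<Sum>i\<in>UNIV. d i) = (norm m)\<^sup>2" "(\<Sum>i\<in>UNIV. f i) = (norm p)\<^sup>2"
    by (simp_all add: d_def f_def power2_norm_eq_sum)
  \<comment> \<open>\<open>P\<close> is the second moment of \<open>p\<close> plus the coordinates
    of \<open>m\<close> with random signs, a vector of mean squared norm 1. \<open>A2\<close> is the
    same for \<open>N\<close>.\<close>
  have A1: "F p p p p + 6 * Y p d + 3 * X d d - 2 * (\<Sum>i\<in>UNIV. (d i)\<^sup>2 * F (e i) (e i) (e i) (e i))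
     \<le> \<tau> * (1 + 4 * (\<Sum>i\<in>UNIV. f i * d i))"
    using sign_average[of UNIV p "\<lambda>i. m $ i"] sums(1) tr
    unfolding X_def Y_def f_def d_def by simp
  have A2: "F m m m m + 6 * Y m f + 3 * X f f - 2 * (\<Sum>i\<in>UNIV. (f i)\<^sup>2 * F (e i) (e i) (e i) (e i))
     \<le> \<tau> * (1 + 4 * (\<Sum>i\<in>UNIV. f i * d i))"
    using sign_average[of UNIV m "\<lambda>i. p $ i"] sums(2) tr
    unfolding X_def Y_def f_def d_def by (simp add: mult.commute add.commute)
  have E: "(\<Sum>i\<in>UNIV. (g i)\<^sup>2 * F (e i) (e i) (e i) (e i)) \<le> \<tau> * (\<Sum>i\<in>UNIV. (g i)\<^sup>2)" for g
    unfolding sum_distrib_left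
  proof (intro sum_mono)
    fix i
    have "F (e i) (e i) (e i) (e i) \<le> \<tau>" using up[of "e i"] by simp
    then show "(g i)\<^sup>2 * F (e i) (e i) (e i) (e i) \<le> \<tau> * (g i)\<^sup>2"
      by (metis mult.commute mult_right_mono zero_le_power2)
  qed
  have fd: "f i + d i = ((u $ i)\<^sup>2 + s) / 2" for i
    unfolding f_def d_def p_def m_def using x4[of i] by (simp add: power2_eq_square algebra_simps)
  have u4: "(\<Sum>i\<in>UNIV. ((u $ i)\<^sup>2)\<^sup>2) \<le> 1" 
  proof -
    have "(\<Sum>i\<in>UNIV. ((u $ i)\<^sup>2)\<^sup>2) \<le> (\<Sum>i\<in>UNIV. (u $ i)\<^sup>2 * 1)"
    proof (intro sum_mono)
      fix i
      have "\<bar>u $ i\<bar> \<le> 1" using component_le_norm_cart[of u i] assms by simp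
      then have "(u $ i)\<^sup>2 \<le> 1" by (simp add: abs_square_le_1)
      then show "((u $ i)\<^sup>2)\<^sup>2 \<le> (u $ i)\<^sup>2 * 1" unfolding power2_eq_square[of "(u $ i)\<^sup>2"]
        by (intro mult_left_mono) auto
    qed
    then show ?thesis using assms(1) power2_norm_eq_sum[of u] by simp
  qed
  have ns: "(\<Sum>i\<in>(UNIV::'n set). s) = 1" 
    using assms(2) power2_norm_eq_sum[of x] x4 by simp
  have "(\<Sum>i\<in>UNIV. (f i + d i)\<^sup>2) = (1/4) * (\<Sum>i\<in>UNIV. ((u $ i)\<^sup>2)\<^sup>2 + 2 * s * (u $ i)\<^sup>2 + s * s)"
    unfolding fd sum_distrib_left by (intro sum.cong) (auto simp: power2_eq_square algebra_simps)
  also have "\<dots> = (1/4) * ((\<Sum>i\<in>UNIV. ((u $ i)\<^sup>2)\<^sup>2) + 2 * s * (norm u)\<^sup>2 + s * (\<Sum>i\<in>(UNIV::'n set). s))"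
    by (simp only: sum.distrib sum_distrib_left[symmetric] power2_norm_eq_sum)
  also have "\<dots> \<le> (1 + 3 * s) / 4" unfolding ns using u4 assms(1) by simp
  finally have fd2: "(\<Sum>i\<in>UNIV. (f i + d i)\<^sup>2) \<le> (1 + 3 * s) / 4" .
  \<comment> \<open>The difference of the two sides is the sum of the
    \<open>(f i - d i)^2\<close>.\<close>
  have extra: "8 * (\<Sum>i\<in>UNIV. f i * d i) + 2 * (\<Sum>i\<in>UNIV. (f i)\<^sup>2) + 2 * (\<Sum>i\<in>UNIV. (d i)\<^sup>2)
     \<le> 3 * (\<Sum>i\<in>UNIV. (f i + d i)\<^sup>2)"
    unfolding sum_distrib_left sum.distrib[symmetric]
  proof (intro sum_mono)
    fix i
    have "0 \<le> (f i - d i)\<^sup>2" by simp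
    then show "8 * (f i * d i) + 2 * (f i)\<^sup>2 + 2 * (d i)\<^sup>2 \<le> 3 * (f i + d i)\<^sup>2"
      by (simp add: power2_eq_square algebra_simps)
  qed
  define Sfd Sff Sdd where S: "Sfd = (\<Sum>i\<in>UNIV. f i * d i)" "Sff = (\<Sum>i\<in>UNIV. (f i)\<^sup>2)"
    "Sdd = (\<Sum>i\<in>UNIV. (d i)\<^sup>2)"
  have "\<tau> * (8 * Sfd + 2 * Sff + 2 * Sdd) \<le> \<tau> * (3 * (1 + 3 * s) / 4)"
    by (intro mult_left_mono tau_nonneg) (use extra fd2 S in simp)
  then have R: "8 * (\<tau> * Sfd) + 2 * (\<tau> * Sff) + 2 * (\<tau> * Sdd) \<le> 3/4 * \<tau> + 9/4 * (\<tau> * s)"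
    by (simp add: algebra_simps)
  have Fpm: "F p p p p + F m m m m \<le> \<tau>"
  proof -
    have "((norm p)\<^sup>2)\<^sup>2 + ((norm m)\<^sup>2)\<^sup>2 \<le> ((norm p)\<^sup>2 + (norm m)\<^sup>2)\<^sup>2"
      by (simp add: power2_eq_square algebra_simps)
    then have "\<tau> * ((norm p)\<^sup>2)\<^sup>2 + \<tau> * ((norm m)\<^sup>2)\<^sup>2 \<le> \<tau>"
      unfolding tr using tau_nonneg by (metis distrib_left mult.right_neutral mult_left_mono power_one)
    then show ?thesis using up[of p] up[of m] by simp
  qed
  have "F p p p p + 6 * Y p d + 3 * X d d \<le> \<tau> + 4 * (\<tau> * Sfd) + 2 * (\<tau> * Sdd)"
    using A1 E[of d] unfolding S[symmetric] by (simp add: algebra_simps)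
  moreover have "F m m m m + 6 * Y m f + 3 * X f f \<le> \<tau> + 4 * (\<tau> * Sfd) + 2 * (\<tau> * Sff)"
    using A2 E[of f] unfolding S[symmetric] by (simp add: algebra_simps)
  ultimately have "3 * (Y p d * 2 + X d d + 2 * Y m f + X f f) + F p p p p + F m m m m
     \<le> 11/4 * \<tau> + 9/4 * (\<tau> * s)"
    using R by argo
  \<comment> \<open>Eight times the last bound plus four times \<open>Fpm\<close> gives
    \<open>26 + 18 s\<close>. The terms pairing \<open>P\<close> with \<open>N\<close> enter with a
    negative sign and are dropped by positivity.\<close>
  then show ?thesis
    unfolding F1 S2 S3 
    using Fpm Xpos[of f d] Xsym[of f d] Ypos[of f p] Ypos[of d m] d0 nonneg[of p m]
    by (simp add: algebra_simps)
qed

text \<open>Adding the nonnegative diagonal and expanding around \<open>x\<close> itself leaves the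
  expression of \<open>offdiagonal_seminorm_le\<close>, at most \<open>26 n + 18\<close> after
  rescaling \<open>x\<close> to norm 1, and the cubic terms \<open>?C\<close>, contributing at most
  \<open>16 (sqrt n + 1)\<close>, all times \<open>\<tau>\<close>. The sum is below
  \<open>36 n\<close> from \<open>n = 8\<close> on.\<close>

lemma hess_quadratic_le_large:
  assumes x: "x \<in> cube" and n: "CARD('n) \<ge> 8" and u: "norm u = 1"
  shows "(\<Sum>i\<in>UNIV. \<Sum>j\<in>UNIV - {i}. u $ i * u $ j * hess x i j) \<le> 36 * (real CARD('n) * \<tau>)"
proof -
  define N where "N = real CARD('n)"
  have N8: "N \<ge> 8" using n by (simp add: N_def)
  define G where "G = (\<lambda>i j. 12 * F (e i) (e j) x x - 24 * x $ i * F (e i) (e i) (e j) x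
    - 24 * x $ j * F (e j) (e j) (e i) x + 16 * F (e i) (e i) (e i) (e j) + 16 * F (e j) (e j) (e j) (e i)
    + 24 * x $ i * x $ j * F (e i) (e i) (e j) (e j))"
  have x2: "x $ i * x $ i = 1" for i using cube_component_sq[OF x] by (simp add: power2_eq_square)
  have hG: "hess x i j = G i j" for i j
  proof -
    have "hess x i j = 12 * F (e i) (e j) x x - 24 * x $ i * F (e i) (e i) (e j) x
      - 24 * x $ j * F (e i) (e j) (e j) x + 12 * (x $ i * x $ i) * F (e i) (e i) (e i) (e j)
      + 12 * (x $ j * x $ j) * F (e i) (e j) (e j) (e j)
      + 24 * x $ i * x $ j * F (e i) (e j) (e i) (e j)
      + 4 * F (e i) (e i) (e i) (e j) + 4 * F (e i) (e j) (e j) (e j)"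
      unfolding hess_def Let_def
      by (simp add: multilinear swap34[of _ _ x "e i"] swap34[of _ _ x "e j"]
          swap34[of _ _ "e j" "e i"] swap23[of _ "e j" "e i"] algebra_simps)
    moreover have "F (e i) (e j) (e j) x = F (e j) (e j) (e i) x" by (metis swap13)
    moreover have "F (e i) (e j) (e j) (e j) = F (e j) (e j) (e j) (e i)" by (metis swap13 swap34)
    moreover have "F (e i) (e j) (e i) (e j) = F (e i) (e i) (e j) (e j)" by (metis swap23)
    ultimately show ?thesis unfolding G_def x2 by simp
  qed
  let ?A = "\<Sum>i\<in>UNIV. u $ i * x $ i * F (e i) (e i) u x"
  let ?B = "\<Sum>i\<in>UNIV. \<Sum>j\<in>UNIV. (u $ i * x $ i) * (u $ j * x $ j) * F (e i) (e i) (e j) (e j)"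
  let ?C = "\<Sum>i\<in>UNIV. u $ i * F (e i) (e i) (e i) u"
  let ?D = "\<Sum>i\<in>UNIV. (u $ i)\<^sup>2 * G i i"
  have full: "(\<Sum>i\<in>UNIV. \<Sum>j\<in>UNIV. u $ i * u $ j * G i j) = 12 * F u u x x - 48 * ?A + 24 * ?B + 32 * ?C"
  proof -
    have 1: "(\<Sum>i\<in>UNIV. \<Sum>j\<in>UNIV. u $ i * u $ j * F (e i) (e j) x x) = F u u x x"
    proof -
      have "F u u x x = (\<Sum>i\<in>UNIV. u $ i * F x u x (e i))"
        using expand4[of x u x u] by (metis swap13 swap24 swap34)
      also have "\<dots> = (\<Sum>i\<in>UNIV. u $ i * F x (e i) x u)"
        by (simp add: swap24[of x u])
      also have "\<dots> = (\<Sum>i\<in>UNIV. \<Sum>j\<in>UNIV. u $ i * (u $ j * F x (e i) x (e j)))"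
        by (subst expand4) (simp add: sum_distrib_left)
      also have "\<dots> = (\<Sum>i\<in>UNIV. \<Sum>j\<in>UNIV. u $ i * u $ j * F (e i) (e j) x x)"
        by (intro sum.cong refl) (metis mult.assoc swap12 swap24 )
      finally show ?thesis by simp
    qed
    have 2: "(\<Sum>i\<in>UNIV. \<Sum>j\<in>UNIV. u $ i * u $ j * (x $ i * F (e i) (e i) (e j) x)) = ?A"
      by (simp add: expand4[of _ _ x u] swap34[of _ _ _ x] sum_distrib_left mult_ac)
    have c2: "(\<Sum>i\<in>UNIV. \<Sum>j\<in>UNIV. u $ i * u $ j * (x $ j * F (e j) (e j) (e i) x)) = ?A"
      by (subst sum.swap) (use 2 in \<open>simp add: mult_ac\<close>)
    have 3: "(\<Sum>i\<in>UNIV. \<Sum>j\<in>UNIV. u $ i * u $ j * F (e i) (e i) (e i) (e j)) = ?C"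
      by (simp add: expand4[of _ _ _ u] sum_distrib_left mult_ac)
    have c3: "(\<Sum>i\<in>UNIV. \<Sum>j\<in>UNIV. u $ i * u $ j * F (e j) (e j) (e j) (e i)) = ?C"
      by (subst sum.swap) (use 3 in \<open>simp add: mult_ac\<close>)
    have 4: "(\<Sum>i\<in>UNIV. \<Sum>j\<in>UNIV. u $ i * u $ j * (x $ i * x $ j * F (e i) (e i) (e j) (e j))) = ?B"
      by (simp add: mult_ac)
    have "(\<Sum>i\<in>UNIV. \<Sum>j\<in>UNIV. u $ i * u $ j * G i j) =
       12 * (\<Sum>i\<in>UNIV. \<Sum>j\<in>UNIV. u $ i * u $ j * F (e i) (e j) x x)
       - 24 * (\<Sum>i\<in>UNIV. \<Sum>j\<in>UNIV. u $ i * u $ j * (x $ i * F (e i) (e i) (e j) x))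
       - 24 * (\<Sum>i\<in>UNIV. \<Sum>j\<in>UNIV. u $ i * u $ j * (x $ j * F (e j) (e j) (e i) x))
       + 16 * (\<Sum>i\<in>UNIV. \<Sum>j\<in>UNIV. u $ i * u $ j * F (e i) (e i) (e i) (e j))
       + 16 * (\<Sum>i\<in>UNIV. \<Sum>j\<in>UNIV. u $ i * u $ j * F (e j) (e j) (e j) (e i))
       + 24 * (\<Sum>i\<in>UNIV. \<Sum>j\<in>UNIV. u $ i * u $ j * (x $ i * x $ j * F (e i) (e i) (e j) (e j)))"
      unfolding G_def sum_distrib_left sum.distrib[symmetric] sum_subtractf[symmetric]
      by (intro sum.cong refl) (simp add: algebra_simps)
    then show ?thesis unfolding 1 2 c2 3 c3 4 by simp
  qed
  have off: "(\<Sum>i\<in>UNIV. \<Sum>j\<in>UNIV - {i}. u $ i * u $ j * G i j)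
     = (\<Sum>i\<in>UNIV. \<Sum>j\<in>UNIV. u $ i * u $ j * G i j) - ?D"
    by (simp add: sum_diff1 sum_subtractf power2_eq_square)
  have D: "?D \<ge> 0"
  proof (intro sum_nonneg mult_nonneg_nonneg)
    fix i
    \<comment> \<open>This is \<open>x\<close> with its \<open>i\<close>-th coordinate flipped;
      completing the square around it exhibits the diagonal entry as a sum of nonnegative
      values.\<close>
    let ?z = "x - (2 * x $ i) *\<^sub>R e i"
    have "F (e i) (e i) ?z ?z = F (e i) (e i) x x - 4 * x $ i * F (e i) (e i) (e i) x
        + 4 * (x $ i * x $ i) * F (e i) (e i) (e i) (e i)"
      by (simp add: multilinear swap34[of _ _ x "e i"] algebra_simps)
    then have "G i i = 12 * F (e i) (e i) ?z ?z + 8 * F (e i) (e i) (e i) (e i)"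
      unfolding G_def using x2[of i] by simp
    then show "0 \<le> G i i" using nonneg[of "e i" ?z] nonneg[of "e i" "e i"] by simp
  qed simp
  have C: "?C \<le> \<tau> * (sqrt N + 1) / 2"
  proof -
    have "?C \<le> (\<Sum>i\<in>UNIV. \<tau> / 2 * (\<bar>u $ i\<bar> + (u $ i)\<^sup>2))"
    proof (intro sum_mono)
      fix i
      have "\<bar>F (e i) u (e i) (e i)\<bar> \<le> \<tau> * ((1 + \<bar>u $ i\<bar>) / 2)"
        using abs_mixed_le[of "e i" u "e i"] u by (simp add: inner_axis')
      then have "\<bar>F (e i) (e i) (e i) u\<bar> \<le> \<tau> * ((1 + \<bar>u $ i\<bar>) / 2)"
        by (metis swap24)
      then have "\<bar>u $ i\<bar> * \<bar>F (e i) (e i) (e i) u\<bar> \<le> \<bar>u $ i\<bar> * (\<tau> * ((1 + \<bar>u $ i\<bar>) / 2))"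
        by (intro mult_left_mono) auto
      then have "u $ i * F (e i) (e i) (e i) u \<le> \<bar>u $ i\<bar> * (\<tau> * ((1 + \<bar>u $ i\<bar>) / 2))"
        using abs_ge_self[of "u $ i * F (e i) (e i) (e i) u"] unfolding abs_mult by linarith
      then show "u $ i * F (e i) (e i) (e i) u \<le> \<tau> / 2 * (\<bar>u $ i\<bar> + (u $ i)\<^sup>2)"
        by (simp add: power2_eq_square algebra_simps flip: abs_mult)
    qed
    also have "\<dots> = \<tau> / 2 * ((\<Sum>i\<in>UNIV. \<bar>u $ i\<bar>) + (norm u)\<^sup>2)"
      by (simp only: sum_distrib_left[symmetric] sum.distrib power2_norm_eq_sum)
    also have "\<dots> \<le> \<tau> / 2 * (sqrt N + 1)"
      using sum_abs_le_sqrt[of u UNIV] u tau_nonneg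
      by (intro mult_left_mono) (auto simp: N_def)
    finally show ?thesis by simp
  qed
  define s where "s = 1 / sqrt N"
  have s2: "s * s = 1 / N" using N8 by (simp add: s_def)
  define x' where "x' = s *\<^sub>R x"
  have nx: "norm x' = 1"
  proof -
    have "(norm x)\<^sup>2 = N" unfolding power2_norm_eq_sum cube_component_sq[OF x] N_def by simp
    then have "norm x = sqrt N" by (metis norm_ge_zero real_sqrt_unique)
    then show ?thesis using N8 by (simp add: x'_def s_def)
  qed
  have "12 * F u u x' x' - 48 * (\<Sum>i\<in>UNIV. u $ i * x' $ i * F (e i) (e i) u x')
      + 24 * (\<Sum>i\<in>UNIV. \<Sum>j\<in>UNIV. (u $ i * x' $ i) * (u $ j * x' $ j) * F (e i) (e i) (e j) (e j))
    \<le> \<tau> * (26 + 18 * (1 / N))"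
    by (rule offdiagonal_seminorm_le[OF u nx])
       (use s2 cube_component_sq[OF x] in \<open>simp add: x'_def power_mult_distrib flip: power2_eq_square\<close>)
  moreover have "F u u x' x' = F u u x x / N"
    using s2 by (simp add: x'_def scale3 scale4 flip: mult.assoc)
  moreover have "(\<Sum>i\<in>UNIV. u $ i * x' $ i * F (e i) (e i) u x') = ?A / N"
    unfolding sum_divide_distrib
  proof (intro sum.cong refl)
    fix i
    have "u $ i * x' $ i * F (e i) (e i) u x' = (s * s) * (u $ i * x $ i * F (e i) (e i) u x)"
      by (simp add: x'_def scale4 mult_ac)
    then show "u $ i * x' $ i * F (e i) (e i) u x' = u $ i * x $ i * F (e i) (e i) u x / N"
      unfolding s2 by simp
  qed
  moreover have "(\<Sum>i\<in>UNIV. \<Sum>j\<in>UNIV. (u $ i * x' $ i) * (u $ j * x' $ j) * F (e i) (e i) (e j) (e j)) = ?B / N"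
    unfolding sum_divide_distrib
  proof (intro sum.cong refl)
    fix i j
    have "(u $ i * x' $ i) * (u $ j * x' $ j) * F (e i) (e i) (e j) (e j)
      = (s * s) * ((u $ i * x $ i) * (u $ j * x $ j) * F (e i) (e i) (e j) (e j))"
      by (simp add: x'_def mult_ac)
    then show "(u $ i * x' $ i) * (u $ j * x' $ j) * F (e i) (e i) (e j) (e j)
       = (u $ i * x $ i) * (u $ j * x $ j) * F (e i) (e i) (e j) (e j) / N"
      unfolding s2 by simp
  qed
  ultimately have "(12 * F u u x x - 48 * ?A + 24 * ?B) / N \<le> \<tau> * (26 + 18 / N)"
    by (simp add: add_divide_distrib diff_divide_distrib)
  moreover have "\<tau> * (26 + 18 / N) = \<tau> * (26 * N + 18) / N"
    using N8 by (simp add: field_simps)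
  ultimately have main: "12 * F u u x x - 48 * ?A + 24 * ?B \<le> \<tau> * (26 * N + 18)"
    using N8 by (simp only: divide_le_cancel)
  define r where "r = sqrt N"
  have r: "r * r = N" "r \<ge> 141 / 50"
  proof -
    show "r \<ge> 141 / 50"
      unfolding r_def by (rule real_le_rsqrt) (use N8 in \<open>simp add: power2_eq_square\<close>)
  qed (use N8 in \<open>simp add: r_def\<close>)
  have "16 * r + 34 \<le> 10 * N"
  proof -
    \<comment> \<open>\<open>141/50\<close> lies just below \<open>sqrt 8\<close>. The product
      expands to \<open>10 r^2 - 16 r - 34.404\<close>.\<close>
    have "0 \<le> (r - 141/50) * (10 * r + 61/5)" using r by (intro mult_nonneg_nonneg) auto
    then show ?thesis using r N8 by (simp add: algebra_simps)
  qed
  then have "\<tau> * (26 * N + 18) + 16 * (\<tau> * (r + 1)) \<le> \<tau> * (36 * N)"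
    using mult_left_mono[OF _ tau_nonneg, of "26 * N + 18 + 16 * (r + 1)" "36 * N"]
    by (simp add: algebra_simps)
  moreover have "32 * ?C \<le> 16 * (\<tau> * (r + 1))"
    using C by (simp add: r_def)
  ultimately have "12 * F u u x x - 48 * ?A + 24 * ?B + 32 * ?C - ?D \<le> \<tau> * (36 * N)"
    using main D by argo
  then show ?thesis
    unfolding hG off full N_def[symmetric] by (simp add: mult_ac)
qed

lemma hess_quadratic_le:
  assumes "x \<in> cube"
  shows "(\<Sum>i\<in>UNIV. \<Sum>j\<in>UNIV - {i}. u $ i * u $ j * hess x i j) \<le> 36 * (real CARD('n) * \<tau>) * (norm u)\<^sup>2"
proof (cases "CARD('n) \<le> 7 \<or> u = 0")
  case True
  then show ?thesis using hess_quadratic_le_small[OF assms] by auto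
next
  case False
  define v where "v = sgn u"
  have u: "u $ i = norm u * v $ i" for i using False by (simp add: v_def sgn_div_norm)
  have "(\<Sum>i\<in>UNIV. \<Sum>j\<in>UNIV - {i}. u $ i * u $ j * hess x i j)
     = (norm u)\<^sup>2 * (\<Sum>i\<in>UNIV. \<Sum>j\<in>UNIV - {i}. v $ i * v $ j * hess x i j)"
    by (simp add: u sum_distrib_left power2_eq_square mult_ac)
  also have "\<dots> \<le> (norm u)\<^sup>2 * (36 * (real CARD('n) * \<tau>))"
    by (intro mult_left_mono hess_quadratic_le_large assms) (use False in \<open>auto simp: v_def norm_sgn\<close>)
  finally show ?thesis by (simp add: mult_ac)
qed

end

section \<open>Glauber dynamics\<close>

lemma flip_flip [simp]: "flip i (flip i x) = x"
  by (simp add: flip_def vec_eq_iff)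

lemma flip_commute: "flip i (flip j x) = flip j (flip i x)"
  by (simp add: flip_def vec_eq_iff)

lemma flip_in_cube [simp]: "flip i x \<in> cube \<longleftrightarrow> x \<in> cube"
proof -
  have "flip i y \<in> cube" if "y \<in> cube" for y
    using that by (auto simp: cube_def flip_def)
  from this[of x] this[of "flip i x"] show ?thesis by auto
qed

text \<open>Indexing the points by subsets gives finiteness, induction along flips, and later a
  finite type of coordinates for functions on the cube.\<close>

definition cube_point :: "'n::finite set \<Rightarrow> real ^ 'n" where
  "cube_point S = (\<chi> i. if i \<in> S then 1 else - 1)"

lemma cube_point_in_cube [simp]: "cube_point S \<in> cube"
  by (simp add: cube_point_def cube_def)

lemma cube_point_positive_coords: "x \<in> cube \<Longrightarrow> cube_point {i. x $ i = 1} = x"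
  by (auto simp: cube_point_def cube_def vec_eq_iff) metis

lemma positive_coords_cube_point [simp]: "{i. cube_point S $ i = 1} = S"
  by (simp add: cube_point_def)

lemma finite_cube [simp]: "finite (cube :: (real ^ 'n::finite) set)"
proof -
  have "cube \<subseteq> range (cube_point :: 'n set \<Rightarrow> _)"
    using cube_point_positive_coords by (metis rangeI subsetI)
  then show ?thesis by (rule finite_subset) simp
qed

lemma sum_flip: "(\<Sum>x\<in>cube. g (flip i x)) = (\<Sum>x\<in>cube. g x)"
  by (rule sum.reindex_bij_witness[of _ "flip i" "flip i"]) auto

text \<open>Reduces an identity or inequality between sums over the cube to a single edge in
  direction \<open>i\<close>.\<close>

lemma sum_cube_pair:
  fixes g :: "real ^ 'n::finite \<Rightarrow> real"
  shows "(\<Sum>x\<in>cube. g x) = (\<Sum>x\<in>cube. g x + g (flip i x)) / 2"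
  by (simp add: sum.distrib sum_flip)

lemma flip_invariant_imp_constant:
  assumes "\<And>i x. x \<in> cube \<Longrightarrow> g (flip i x) = g x" and "x \<in> cube" "y \<in> cube"
  shows "g x = g y"
proof -
  have "g (cube_point S) = g (cube_point {})" for S :: "'a set"
    using finite[of S]
  proof (induction S rule: finite_induct)
    case (insert i S)
    then have "cube_point (insert i S) = flip i (cube_point S)"
      by (auto simp: cube_point_def flip_def vec_eq_iff)
    then show ?case using assms(1) insert.IH by simp
  qed simp
  then show ?thesis using assms(2,3) by (metis cube_point_positive_coords)
qed

section \<open>Conditional expectations and the Bochner inequality\<close>

locale cube_weight =
  fixes m :: "real ^ 'n::finite \<Rightarrow> real"
  assumes pos: "x \<in> cube \<Longrightarrow> 0 < m x"
begin

definition cond :: "'n \<Rightarrow> real ^ 'n \<Rightarrow> real" where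
  "cond i x = m x / (m x + m (flip i x))"

text \<open>\<open>f\<close> minus its conditional expectation given all coordinates but the \<open>i\<close>-th; the negative of the
  generator of the Glauber dynamics is the sum over \<open>i\<close>.\<close>

definition resid :: "'n \<Rightarrow> (real ^ 'n \<Rightarrow> real) \<Rightarrow> real ^ 'n \<Rightarrow> real" where
  "resid i f x = (f x - f (flip i x)) * (m (flip i x) / (m x + m (flip i x)))"

text \<open>Bilinear because the duality argument pairs a solution of the generator equation with
  the given function; on the diagonal it is the Dirichlet form.\<close>

definition energy :: "(real ^ 'n \<Rightarrow> real) \<Rightarrow> (real ^ 'n \<Rightarrow> real) \<Rightarrow> real" where
  "energy f g = (\<Sum>i\<in>UNIV. \<Sum>x\<in>cube. m x * (resid i f x * resid i g x))"

text \<open>On the four points \<open>x\<close>, \<open>x\<^sup>(\<^sup>i\<^sup>)\<close>, \<open>x\<^sup>(\<^sup>j\<^sup>)\<close>, \<open>x\<^sup>(\<^sup>i\<^sup>j\<^sup>)\<close> this vanishes iff \<open>x\<^sub>i\<close> and \<open>x\<^sub>j\<close> are conditionally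
  independent.\<close>

definition coupling :: "'n \<Rightarrow> 'n \<Rightarrow> real ^ 'n \<Rightarrow> real" where
  "coupling i j x = 1 - m (flip i x) * m (flip j x) / (m x * m (flip i (flip j x)))"

text \<open>With \<open>\<rho>\<close> the product of the two conditional probabilities,
  \<open>1 / (1 - \<rho> * coupling) = 1 + \<rho> * kernel\<close>. The kernel thus measures how far
  the product of two residuals is from the expression shown nonnegative in
  \<open>mixed_resid_nonneg\<close>.\<close>

definition kernel :: "'n \<Rightarrow> 'n \<Rightarrow> real ^ 'n \<Rightarrow> real" where
  "kernel i j x = coupling i j x / (1 - cond i x * cond j x * coupling i j x)"

text \<open>Coordinates on an edge: total mass \<open>s\<close> and conditional probabilities
  \<open>r\<close> and \<open>p\<close>. They make the edge identities polynomial.\<close>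

lemma edge_cases:
  assumes "x \<in> cube"
  obtains s r p where "0 < s" "0 < r" "0 < p" "r + p = 1" "m x = r * s" "m (flip i x) = p * s"
    "cond i x = r" "cond i (flip i x) = p"
    "\<And>f. resid i f x = (f x - f (flip i x)) * p"
    "\<And>f. resid i f (flip i x) = - (f x - f (flip i x)) * r"
    "m x * m (flip i x) / (m x + m (flip i x)) = r * p * s"
proof -
  define s where "s = m x + m (flip i x)"
  have p: "m x > 0" "m (flip i x) > 0" using assms pos by simp_all
  then have s: "s > 0" by (simp add: s_def)
  have s': "m (flip i x) + m x = s" by (simp add: s_def)
  show ?thesis
    by (rule that[of s "m x / s" "m (flip i x) / s"])
      (use p s in \<open>simp_all add: cond_def resid_def s' flip: s_def add_divide_distrib\<close>)
qed

text \<open>\<open>resid i\<close> is an orthogonal projection in the inner product weighted by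
  \<open>m\<close>; its complement projects onto the functions that do not depend on coordinate
  \<open>i\<close>.\<close>

lemma resid_sum_by_parts:
  "(\<Sum>x\<in>cube. m x * (resid i f x * g x)) = (\<Sum>x\<in>cube. m x * (resid i f x * resid i g x))"
proof -
  have "m x * (resid i f x * g x) + m (flip i x) * (resid i f (flip i x) * g (flip i x))
    = m x * (resid i f x * resid i g x) + m (flip i x) * (resid i f (flip i x) * resid i g (flip i x))"
    if x: "x \<in> cube" for x
  proof (rule edge_cases[OF x, of i], goal_cases)
    case (1 s r p)
    have p: "p = 1 - r" using 1(4) by simp
    show ?case unfolding 1(5,6) 1(9,10) unfolding p by (simp add: algebra_simps)
  qed
  then show ?thesis by (subst (1 2) sum_cube_pair[of _ i]) simp
qed

lemma energy_eq_generator: "energy f g = (\<Sum>x\<in>cube. m x * ((\<Sum>i\<in>UNIV. resid i f x) * g x))"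
  unfolding energy_def resid_sum_by_parts[symmetric]
  by (subst sum.swap) (simp add: sum_distrib_left sum_distrib_right)

lemma resid_sq_pair:
  assumes "x \<in> cube"
  shows "m x * (resid i f x * resid i f x) + m (flip i x) * (resid i f (flip i x) * resid i f (flip i x))
    = (f x - f (flip i x))\<^sup>2 * (m x * m (flip i x) / (m x + m (flip i x)))"
proof (rule edge_cases[OF assms, of i], goal_cases)
  case (1 s r p)
  have p: "p = 1 - r" using 1(4) by simp
  show ?case
    unfolding 1(11) unfolding 1(5,6) 1(9,10) unfolding p by (simp add: power2_eq_square algebra_simps)
qed

lemma energy_eq_edges:
  "energy f f = 1 / 2 * (\<Sum>x\<in>cube. \<Sum>i\<in>UNIV.
     (f x - f (flip i x))\<^sup>2 * (m x * m (flip i x) / (m x + m (flip i x))))"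
proof -
  have "(\<Sum>x\<in>cube. m x * (resid i f x * resid i f x))
    = (\<Sum>x\<in>cube. (f x - f (flip i x))\<^sup>2 * (m x * m (flip i x) / (m x + m (flip i x)))) / 2" for i
    by (subst sum_cube_pair[of _ i]) (simp add: resid_sq_pair cong: sum.cong)
  then have "energy f f = (\<Sum>i\<in>UNIV.
      (\<Sum>x\<in>cube. (f x - f (flip i x))\<^sup>2 * (m x * m (flip i x) / (m x + m (flip i x)))) / 2)"
    unfolding energy_def by (intro sum.cong refl)
  also have "\<dots> = 1 / 2 * (\<Sum>i\<in>UNIV. \<Sum>x\<in>cube.
      (f x - f (flip i x))\<^sup>2 * (m x * m (flip i x) / (m x + m (flip i x))))"
    by (simp flip: sum_divide_distrib)
  finally show ?thesis by (subst sum.swap)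
qed

text \<open>On an edge with conditional probabilities \<open>r\<close> and \<open>p = 1 - r\<close> the two sides are \<open>p r\<close> and \<open>1 / 4\<close>
  times the same quantity.\<close>

lemma cond_resid_sq_le:
  "(\<Sum>x\<in>cube. m x * (cond i x * resid i f x)\<^sup>2) \<le> 1 / 4 * (\<Sum>x\<in>cube. m x * (resid i f x * resid i f x))"
proof -
  have "m x * (cond i x * resid i f x)\<^sup>2 + m (flip i x) * (cond i (flip i x) * resid i f (flip i x))\<^sup>2
    \<le> 1 / 4 * (m x * (resid i f x * resid i f x) + m (flip i x) * (resid i f (flip i x) * resid i f (flip i x)))"
    if x: "x \<in> cube" for x
  proof (rule edge_cases[OF x, of i], goal_cases)
    case (1 s r p)
    define d where "d = f x - f (flip i x)"
    have p: "p = 1 - r" using 1(4) by simp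
    have "m x * (cond i x * resid i f x)\<^sup>2 + m (flip i x) * (cond i (flip i x) * resid i f (flip i x))\<^sup>2
      = (d\<^sup>2 * (r * p * s)) * (r * p)"
      unfolding 1(5-10) d_def[symmetric] unfolding p by (simp add: power2_eq_square algebra_simps)
    also have "\<dots> \<le> (d\<^sup>2 * (r * p * s)) * (1 / 4)"
    proof (rule mult_left_mono)
      have "0 \<le> (r - 1 / 2)\<^sup>2" by simp
      then show "r * p \<le> 1 / 4" unfolding p by (simp add: power2_eq_square algebra_simps)
    qed (use 1 in simp)
    finally show ?case
      unfolding resid_sq_pair[OF x] 1(11) d_def by simp
  qed
  then have "(\<Sum>x\<in>cube. m x * (cond i x * resid i f x)\<^sup>2 + m (flip i x) * (cond i (flip i x) * resid i f (flip i x))\<^sup>2)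
    \<le> (\<Sum>x\<in>cube. 1 / 4 * (m x * (resid i f x * resid i f x) + m (flip i x) * (resid i f (flip i x) * resid i f (flip i x))))"
    by (rule sum_mono)
  then show ?thesis
    by (subst (1 2) sum_cube_pair[of _ i]) (simp add: sum_distrib_left)
qed

text \<open>The weight \<open>(1 / m(x) + 1 / m(x\<^sup>(\<^sup>i\<^sup>)) + 1 / m(x\<^sup>(\<^sup>j\<^sup>)) + 1 / m(x\<^sup>(\<^sup>i\<^sup>j\<^sup>)))\<^sup>-\<^sup>1\<close> is constant on the four points and turns
  the sum over them into the square of the mixed second difference of \<open>f\<close>.\<close>

lemma mixed_resid_nonneg:
  assumes "i \<noteq> j"
  shows "0 \<le> (\<Sum>x\<in>cube. m x * (resid i f x * resid j f x) / (1 - cond i x * cond j x * coupling i j x))"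
proof -
  define w where "w x = 1 / (1 / m x + 1 / m (flip i x) + 1 / m (flip j x) + 1 / m (flip i (flip j x)))" for x
  define h where "h x = w x * ((f x - f (flip i x)) * (f x - f (flip j x)))" for x
  have eq: "m x * (resid i f x * resid j f x) / (1 - cond i x * cond j x * coupling i j x) = h x"
    if "x \<in> cube" for x
  proof -
    define A B C D where "A = m x" and "B = m (flip i x)" and "C = m (flip j x)" and "D = m (flip i (flip j x))"
    have p: "A > 0" "B > 0" "C > 0" "D > 0" using that pos unfolding A_def B_def C_def D_def by simp_all
    have nz: "A + B \<noteq> 0" "A + C \<noteq> 0" using p by simp_all
    define Z where "Z = A * B * D + A * C * D + B * C * D + A * B * C"
    have 1: "1 - (A / (A + B)) * (A / (A + C)) * (1 - B * C / (A * D)) = Z / ((A + B) * (A + C) * D)"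
      using p nz unfolding Z_def by (simp add: divide_simps) (simp add: algebra_simps)
    have "1 / A + 1 / B + 1 / C + 1 / D = Z / (A * B * C * D)"
      using p unfolding Z_def by (simp add: divide_simps) (simp add: algebra_simps)
    then have 2: "w x = A * B * C * D / Z"
      unfolding w_def A_def[symmetric] B_def[symmetric] C_def[symmetric] D_def[symmetric] by simp
    have 3: "A * ((a * (B / (A + B))) * (b * (C / (A + C)))) / (Z / ((A + B) * (A + C) * D))
      = A * B * C * D / Z * (a * b)" for a b
      using p nz by simp
    show ?thesis
      unfolding h_def 2 3[symmetric] resid_def cond_def coupling_def
        A_def[symmetric] B_def[symmetric] C_def[symmetric] D_def[symmetric] 1 by (rule refl)
  qed
  have w1: "w (flip i x) = w x" for x
    unfolding w_def by (simp add: flip_commute[of j i] add_ac)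
  have w2: "w (flip j x) = w x" for x
    unfolding w_def by (simp add: flip_commute[of i j] add_ac)
  have "(\<Sum>x\<in>cube. h x) = (\<Sum>x\<in>cube. (h x + h (flip i x)) + (h (flip j x) + h (flip i (flip j x)))) / 4"
    using sum_cube_pair[of h i] sum_cube_pair[of "\<lambda>x. h x + h (flip i x)" j] by simp
  also have "\<dots> = (\<Sum>x\<in>cube. w x * ((f x - f (flip i x)) - (f (flip j x) - f (flip i (flip j x))))\<^sup>2) / 4"
    by (simp add: h_def w1 w2 flip_commute[of j i] power2_eq_square algebra_simps)
  also have "\<dots> \<ge> 0"
  proof -
    have "0 \<le> w x" if "x \<in> cube" for x
      unfolding w_def
      by (intro divide_nonneg_nonneg add_nonneg_nonneg less_imp_le[OF pos] zero_le_one) (use that in simp_all)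
    then show ?thesis by (intro divide_nonneg_nonneg sum_nonneg mult_nonneg_nonneg) auto
  qed
  finally show ?thesis using eq by (simp cong: sum.cong)
qed

text \<open>The coupling is below 1 because the cross ratio is positive, and the product of two
  conditional probabilities lies strictly between 0 and 1.\<close>

lemma coupling_denominator_pos:
  assumes "x \<in> cube"
  shows "0 < 1 - cond i x * cond j x * coupling i j x"
proof -
  define A B C D where "A = m x" and "B = m (flip i x)" and "C = m (flip j x)" and "D = m (flip i (flip j x))"
  have p: "A > 0" "B > 0" "C > 0" "D > 0" using assms pos unfolding A_def B_def C_def D_def by simp_all
  have r: "0 < A / (A + B)" "A / (A + B) < 1" "0 < A / (A + C)" "A / (A + C) < 1"
    using p by (simp_all add: add_pos_pos)
  have rr: "0 < A / (A + B) * (A / (A + C))" "A / (A + B) * (A / (A + C)) < 1"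
    using r(1,3) by (rule mult_pos_pos) (use r mult_strict_mono[of "A / (A + B)" 1 "A / (A + C)" 1] in auto)
  have "A / (A + B) * (A / (A + C)) * (1 - B * C / (A * D)) < A / (A + B) * (A / (A + C)) * 1"
    using p rr(1) by (intro mult_strict_left_mono) auto
  then show ?thesis
    using rr(2) unfolding cond_def coupling_def A_def[symmetric] B_def[symmetric] C_def[symmetric] D_def[symmetric]
    by linarith
qed

text \<open>Expanding the square, the diagonal terms give the energy. By
  \<open>mixed_resid_nonneg\<close> the others are at least minus the kernel form at
  \<open>cond * resid\<close>; the factor 4 in \<open>ker\<close> cancels the 1/4 of
  \<open>cond_resid_sq_le\<close>.\<close>

lemma generator_norm_ge:
  assumes "0 \<le> \<delta>"
    and ker: "\<And>x y. x \<in> cube \<Longrightarrow>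
      (\<Sum>i\<in>UNIV. \<Sum>j\<in>UNIV - {i}. y i * y j * kernel i j x) \<le> 4 * \<delta> * (\<Sum>i\<in>UNIV. (y i)\<^sup>2)"
  shows "(1 - \<delta>) * energy f f \<le> (\<Sum>x\<in>cube. m x * (\<Sum>i\<in>UNIV. resid i f x)\<^sup>2)"
proof -
  let ?y = "\<lambda>i x. cond i x * resid i f x"
  have off: "- (\<Sum>x\<in>cube. m x * (?y i x * ?y j x * kernel i j x)) \<le> (\<Sum>x\<in>cube. m x * (resid i f x * resid j f x))"
    if "i \<noteq> j" for i j
  proof -
    have "m x * (resid i f x * resid j f x) / (1 - cond i x * cond j x * coupling i j x)
      = m x * (resid i f x * resid j f x) + m x * (?y i x * ?y j x * kernel i j x)" if "x \<in> cube" for x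
    proof -
      define Z where "Z = 1 - cond i x * cond j x * coupling i j x"
      have Z: "Z \<noteq> 0" using coupling_denominator_pos[OF that, of i j] by (simp add: Z_def)
      have "1 / Z = 1 + cond i x * cond j x * kernel i j x"
        using Z unfolding kernel_def Z_def[symmetric] by (simp add: field_simps) (simp add: Z_def)
      then have "m x * (resid i f x * resid j f x) * (1 / Z)
        = m x * (resid i f x * resid j f x) + m x * (?y i x * ?y j x * kernel i j x)"
        by (simp add: algebra_simps)
      then show ?thesis by (simp add: Z_def)
    qed
    then show ?thesis
      using mixed_resid_nonneg[OF that, of f] by (simp add: sum.distrib cong: sum.cong)
  qed
  have "(\<Sum>x\<in>cube. m x * (\<Sum>i\<in>UNIV. resid i f x)\<^sup>2)
    = energy f f + (\<Sum>i\<in>UNIV. \<Sum>j\<in>UNIV - {i}. \<Sum>x\<in>cube. m x * (resid i f x * resid j f x))"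
  proof -
    have "(\<Sum>i\<in>UNIV. resid i f x)\<^sup>2 = (\<Sum>i\<in>UNIV. resid i f x * resid i f x)
       + (\<Sum>i\<in>UNIV. \<Sum>j\<in>UNIV - {i}. resid i f x * resid j f x)" for x
      by (simp add: power2_eq_square sum_product sum_diff1 sum_subtractf)
    then have "(\<Sum>x\<in>cube. m x * (\<Sum>i\<in>UNIV. resid i f x)\<^sup>2) =
      (\<Sum>x\<in>cube. \<Sum>i\<in>UNIV. m x * (resid i f x * resid i f x))
      + (\<Sum>x\<in>cube. \<Sum>i\<in>UNIV. \<Sum>j\<in>UNIV - {i}. m x * (resid i f x * resid j f x))"
      by (simp add: distrib_left sum.distrib sum_distrib_left)
    also have "(\<Sum>x\<in>cube. \<Sum>i\<in>UNIV. m x * (resid i f x * resid i f x)) = energy f f"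
      unfolding energy_def by (rule sum.swap)
    also have "(\<Sum>x\<in>cube. \<Sum>i\<in>UNIV. \<Sum>j\<in>UNIV - {i}. m x * (resid i f x * resid j f x))
      = (\<Sum>i\<in>UNIV. \<Sum>j\<in>UNIV - {i}. \<Sum>x\<in>cube. m x * (resid i f x * resid j f x))"
      by (subst sum.swap, intro sum.cong refl, rule sum.swap)
    finally show ?thesis .
  qed
  moreover have "(\<Sum>i\<in>UNIV. \<Sum>j\<in>UNIV - {i}. - (\<Sum>x\<in>cube. m x * (?y i x * ?y j x * kernel i j x)))
     \<le> (\<Sum>i\<in>UNIV. \<Sum>j\<in>UNIV - {i}. \<Sum>x\<in>cube. m x * (resid i f x * resid j f x))"
    by (intro sum_mono off) auto
  moreover have "(\<Sum>i\<in>UNIV. \<Sum>j\<in>UNIV - {i}. - (\<Sum>x\<in>cube. m x * (?y i x * ?y j x * kernel i j x)))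
     = - (\<Sum>x\<in>cube. m x * (\<Sum>i\<in>UNIV. \<Sum>j\<in>UNIV - {i}. ?y i x * ?y j x * kernel i j x))"
  proof -
    have "(\<Sum>x\<in>cube. m x * (\<Sum>i\<in>UNIV. \<Sum>j\<in>UNIV - {i}. ?y i x * ?y j x * kernel i j x))
      = (\<Sum>i\<in>UNIV. \<Sum>j\<in>UNIV - {i}. \<Sum>x\<in>cube. m x * (?y i x * ?y j x * kernel i j x))"
      unfolding sum_distrib_left by (subst sum.swap, intro sum.cong refl, rule sum.swap)
    then show ?thesis by (simp add: sum_negf)
  qed
  moreover have "(\<Sum>x\<in>cube. m x * (\<Sum>i\<in>UNIV. \<Sum>j\<in>UNIV - {i}. ?y i x * ?y j x * kernel i j x)) \<le> \<delta> * energy f f"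
  proof -
    have "(\<Sum>x\<in>cube. m x * (\<Sum>i\<in>UNIV. \<Sum>j\<in>UNIV - {i}. ?y i x * ?y j x * kernel i j x))
      \<le> (\<Sum>x\<in>cube. m x * (4 * \<delta> * (\<Sum>i\<in>UNIV. (?y i x)\<^sup>2)))"
      by (intro sum_mono mult_left_mono ker) (auto intro: less_imp_le pos)
    also have "\<dots> = 4 * \<delta> * (\<Sum>i\<in>UNIV. \<Sum>x\<in>cube. m x * (?y i x)\<^sup>2)"
      by (subst sum.swap) (simp add: sum_distrib_left mult_ac)
    also have "\<dots> \<le> 4 * \<delta> * (\<Sum>i\<in>UNIV. 1 / 4 * (\<Sum>x\<in>cube. m x * (resid i f x * resid i f x)))"
      using assms(1) by (intro mult_left_mono sum_mono cond_resid_sq_le) auto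
    also have "\<dots> = \<delta> * energy f f"
      unfolding energy_def sum_distrib_left[symmetric] by simp
    finally show ?thesis .
  qed
  ultimately show ?thesis by (simp add: left_diff_distrib)
qed

section \<open>The Poisson equation and duality\<close>

lemma energy_one: "energy f (\<lambda>_. c) = 0"
  unfolding energy_def by (simp add: resid_def)

lemma energy_eq_0_imp_constant:
  assumes "energy g g = 0" "x \<in> cube" "y \<in> cube"
  shows "g x = g y"
proof (rule flip_invariant_imp_constant)
  fix i and z :: "real ^ 'n" assume z: "z \<in> cube"
  have nn: "0 \<le> m x * (resid i g x * resid i g x)" if "x \<in> cube" for i x
    using pos[OF that] by simp
  then have "(\<Sum>x\<in>cube. m x * (resid i g x * resid i g x)) = 0"
    using assms(1) unfolding energy_def by (subst (asm) sum_nonneg_eq_0_iff) (auto intro: sum_nonneg)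
  then have "m z * (resid i g z * resid i g z) = 0"
    using nn z by (subst (asm) sum_nonneg_eq_0_iff) auto
  then have "resid i g z = 0" using pos[OF z] by simp
  then show "g (flip i z) = g z"
    using pos[OF z] pos[of "flip i z"] z by (simp add: resid_def)
qed (use assms in auto)

text \<open>Adding the mean to the generator makes it injective: a function in the kernel has mean
  0, hence zero energy, hence is constant and so 0. Injective means surjective in finite dimension,
  and for data of mean 0 the added term vanishes.\<close>

lemma generator_solvable:
  assumes prob: "(\<Sum>x\<in>cube. m x) = 1" and mean: "(\<Sum>x\<in>cube. m x * f x) = 0"
  obtains g where "\<And>x. x \<in> cube \<Longrightarrow> (\<Sum>i\<in>UNIV. resid i g x) = f x"
proof -
  \<comment> \<open>Functions on all of \<open>real ^ 'n\<close> form an infinite-dimensional space;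
    the values on the cube are therefore stored as a vector indexed by subsets.\<close>
  define ext :: "real ^ 'n set \<Rightarrow> real ^ 'n \<Rightarrow> real" where "ext h = (\<lambda>x. h $ {i. x $ i = 1})" for h
  define op :: "(real ^ 'n \<Rightarrow> real) \<Rightarrow> real ^ 'n \<Rightarrow> real"
    where "op g x = (\<Sum>i\<in>UNIV. resid i g x) + (\<Sum>y\<in>cube. m y * g y)" for g x
  define A :: "real ^ 'n set \<Rightarrow> real ^ 'n set" where "A h = (\<chi> S. op (ext h) (cube_point S))" for h
  have mean0: "(\<Sum>x\<in>cube. m x * g x) = (\<Sum>x\<in>cube. m x * op g x)" for g
  proof -
    have "(\<Sum>x\<in>cube. m x * ((\<Sum>i\<in>UNIV. resid i g x) * 1)) = 0"
      using energy_one[of g 1] unfolding energy_eq_generator by simp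
    then show ?thesis
      unfolding op_def distrib_left sum.distrib sum_distrib_right[symmetric] prob by simp
  qed
  have lin: "linear A"
  proof (rule linearI)
    show "A (h + k) = A h + A k" for h k
      unfolding A_def op_def ext_def resid_def
      by (simp add: vec_eq_iff sum.distrib[symmetric] algebra_simps add_divide_distrib diff_divide_distrib)
    show "A (c *\<^sub>R h) = c *\<^sub>R A h" for c h
      unfolding A_def op_def ext_def resid_def
      by (simp add: vec_eq_iff sum_distrib_left algebra_simps)
  qed
  have injA: "inj A"
  proof (subst linear_injective_0[OF lin], intro allI impI)
    fix h assume h: "A h = 0"
    have op0: "op (ext h) x = 0" if "x \<in> cube" for x
      using arg_cong[OF h, of "\<lambda>v. v $ {i. x $ i = 1}"] cube_point_positive_coords[OF that]
      by (simp add: A_def)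
    then have z: "(\<Sum>x\<in>cube. m x * ext h x) = 0"
      using mean0[of "ext h"] by simp
    then have "energy (ext h) (ext h) = 0"
      using op0 unfolding energy_eq_generator op_def by simp
    then have c: "ext h x = ext h (cube_point {})" if "x \<in> cube" for x
      using that by (rule energy_eq_0_imp_constant) simp
    have "ext h (cube_point {}) = 0"
    proof -
      have "(\<Sum>x\<in>cube. m x * ext h x) = (\<Sum>x\<in>cube. m x * ext h (cube_point {}))"
        by (intro sum.cong refl arg_cong2[of _ _ _ _ times] c)
      then show ?thesis using z prob by (simp flip: sum_distrib_right)
    qed
    then have "h $ S = 0" for S
      using c[of "cube_point S"] by (simp add: ext_def)
    then show "h = 0" by (simp add: vec_eq_iff)
  qed
  have "surj A" by (intro linear_injective_imp_surjective lin injA refl)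
  then obtain h where h: "A h = (\<chi> S. f (cube_point S))" by (metis surjD)
  have opf: "op (ext h) x = f x" if "x \<in> cube" for x
    using arg_cong[OF h, of "\<lambda>v. v $ {i. x $ i = 1}"] cube_point_positive_coords[OF that]
    by (simp add: A_def)
  then have "(\<Sum>x\<in>cube. m x * ext h x) = 0"
    using mean0[of "ext h"] mean by simp
  then show ?thesis using that[of "ext h"] opf by (simp add: op_def)
qed

text \<open>Solve the generator equation for \<open>g\<close> with the centred function
  \<open>k\<close> as data. Then \<open>Var = energy g k\<close>, at most half of
  \<open>c * energy g g + energy k k / c\<close>, and \<open>gap\<close> bounds
  \<open>c * energy g g\<close> by \<open>Var\<close>, which is absorbed on the left.\<close>

lemma poincare_of_generator_bound:
  assumes prob: "(\<Sum>x\<in>cube. m x) = 1" and "0 < c"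
    and gap: "\<And>f. c * energy f f \<le> (\<Sum>x\<in>cube. m x * (\<Sum>i\<in>UNIV. resid i f x)\<^sup>2)"
  shows "(\<Sum>x\<in>cube. m x * (f x - (\<Sum>y\<in>cube. m y * f y))\<^sup>2) \<le> 1 / c * energy f f"
proof -
  define k where "k x = f x - (\<Sum>y\<in>cube. m y * f y)" for x
  have "(\<Sum>x\<in>cube. m x * k x) = 0"
    unfolding k_def right_diff_distrib sum_subtractf sum_distrib_right[symmetric] prob by simp
  then obtain g where g: "\<And>x. x \<in> cube \<Longrightarrow> (\<Sum>i\<in>UNIV. resid i g x) = k x"
    using generator_solvable[OF prob] by metis
  have kf: "energy h k = energy h f" "energy k k = energy f f" for h
    by (simp_all add: energy_def resid_def k_def)
  let ?V = "\<Sum>x\<in>cube. m x * (k x)\<^sup>2"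
  have V: "?V = energy g k"
    unfolding energy_eq_generator by (intro sum.cong refl) (simp add: g power2_eq_square)
  have "2 * energy g k \<le> c * energy g g + 1 / c * energy k k"
    unfolding energy_def sum_distrib_left sum.distrib[symmetric]
  proof (intro sum_mono)
    fix i and x :: "real ^ 'n" assume "x \<in> cube"
    define a b where "a = resid i g x" and "b = resid i k x"
    have "0 \<le> (c * a - b)\<^sup>2 / c" using assms(2) by simp
    also have "\<dots> = c * (a * a) + 1 / c * (b * b) - 2 * (a * b)"
      using assms(2) by (simp add: power2_eq_square field_simps)
    finally have "m x * (2 * (a * b)) \<le> m x * (c * (a * a) + 1 / c * (b * b))"
      using pos[OF \<open>x \<in> cube\<close>] by (intro mult_left_mono) auto
    then show "2 * (m x * (resid i g x * resid i k x))
      \<le> c * (m x * (resid i g x * resid i g x)) + 1 / c * (m x * (resid i k x * resid i k x))"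
      unfolding a_def[symmetric] b_def[symmetric] by (simp add: algebra_simps)
  qed
  moreover have "c * energy g g \<le> ?V" using gap[of g] g by simp
  ultimately have "?V \<le> 1 / c * energy f f" using V kf(2) by simp
  then show ?thesis unfolding k_def .
qed

end

section \<open>The spectral gap\<close>

text \<open>Taylor expansion with Lagrange remainder: \<open>exp t \<le> 3\<close> bounds the cubic
  term by \<open>3/14 x^2\<close>, less than the spare \<open>1/4 x^2\<close>.\<close>

lemma exp_le_quadratic:
  fixes x :: real
  assumes "\<bar>x\<bar> \<le> 3 / 7"
  shows "exp x \<le> 1 + x + 3 / 4 * x\<^sup>2"
proof -
  obtain t where t: "\<bar>t\<bar> \<le> \<bar>x\<bar>" and e: "exp x = (\<Sum>k<3. x ^ k / fact k) + exp t / fact 3 * x ^ 3"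
    using Maclaurin_exp_le[of x 3] by auto
  have "exp t \<le> exp 1" using t assms by simp
  then have et: "exp t \<le> 3" using exp_le by linarith
  have "exp t * x \<le> exp t * \<bar>x\<bar>" by (intro mult_left_mono) auto
  also have "\<dots> \<le> 3 * (3 / 7)" by (intro mult_mono et assms) auto
  finally have "exp t * x \<le> 3 * (3 / 7)" .
  then have "exp t * x * x\<^sup>2 \<le> 3 * (3 / 7) * x\<^sup>2" by (rule mult_right_mono) simp
  moreover have "exp x = 1 + x + x\<^sup>2 / 2 + exp t * x * x\<^sup>2 / 6"
    unfolding e by (simp add: eval_nat_numeral)
  moreover have "0 \<le> x\<^sup>2" by simp
  ultimately show ?thesis by linarith
qed

text \<open>The quotient increases in \<open>\<rho>\<close>, from \<open>1 - exp (- x)\<close> at \<open>\<rho> = 0\<close> to \<open>exp x - 1\<close> at \<open>\<rho> = 1\<close>.\<close>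

lemma abs_kernel_remainder_le:
  fixes x \<rho> :: real
  assumes "\<bar>x\<bar> \<le> 3 / 7" "0 \<le> \<rho>" "\<rho> \<le> 1"
  defines "v \<equiv> 1 - exp (- x)"
  shows "\<bar>v / (1 - \<rho> * v) - x\<bar> \<le> 3 / 4 * x\<^sup>2"
proof -
  have v1: "v < 1" by (simp add: v_def)
  have pos: "0 < 1 - \<rho> * v"
  proof (cases "v \<le> 0")
    case True
    then show ?thesis using mult_nonneg_nonpos[OF assms(2) True] by linarith
  next
    case False
    then have "\<rho> * v \<le> 1 * v" using assms(3) by (intro mult_right_mono) auto
    then show ?thesis using v1 by linarith
  qed
  have "v * (1 - \<rho> * v) \<le> v" using assms(2) by (simp add: algebra_simps)
  then have lo: "v \<le> v / (1 - \<rho> * v)" using pos by (simp add: pos_le_divide_eq)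
  have ev: "(exp x - 1) * (1 - v) = v"
    unfolding v_def by (simp add: algebra_simps flip: exp_add)
  have "v \<le> (exp x - 1) * (1 - \<rho> * v)"
  proof -
    have "(exp x - 1) * (1 - \<rho> * v) = v + (exp x - 1) * v * (1 - \<rho>)"
      using ev by (simp add: algebra_simps)
    moreover have "(exp x - 1) * v = exp x * v\<^sup>2"
      unfolding v_def by (simp add: power2_eq_square algebra_simps flip: exp_add)
    ultimately show ?thesis using assms(3) by simp
  qed
  then have hi: "v / (1 - \<rho> * v) \<le> exp x - 1" using pos by (simp add: pos_divide_le_eq)
  have "exp x \<le> 1 + x + 3 / 4 * x\<^sup>2" "exp (- x) \<le> 1 - x + 3 / 4 * x\<^sup>2"
    using exp_le_quadratic[of x] exp_le_quadratic[of "- x"] assms(1) by simp_all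
  then show ?thesis
    using lo hi unfolding abs_le_iff by (simp only: v_def) linarith
qed

lemma schur_test:
  fixes b :: "'n::finite \<Rightarrow> 'n \<Rightarrow> real"
  assumes b: "\<And>i j. 0 \<le> b i j" and sym: "\<And>i j. b i j = b j i"
    and row: "\<And>i. (\<Sum>j\<in>UNIV - {i}. b i j) \<le> R"
  shows "(\<Sum>i\<in>UNIV. \<Sum>j\<in>UNIV - {i}. \<bar>y i\<bar> * \<bar>y j\<bar> * b i j) \<le> R * (\<Sum>i\<in>UNIV. (y i)\<^sup>2)"
proof -
  have "(\<Sum>i\<in>UNIV. \<Sum>j\<in>UNIV - {i}. \<bar>y i\<bar> * \<bar>y j\<bar> * b i j)
    \<le> (\<Sum>i\<in>UNIV. \<Sum>j\<in>UNIV - {i}. (y i)\<^sup>2 * b i j / 2 + (y j)\<^sup>2 * b j i / 2)"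
  proof (intro sum_mono)
    fix i j
    have "0 \<le> (\<bar>y i\<bar> - \<bar>y j\<bar>)\<^sup>2 * b i j" using b by simp
    then show "\<bar>y i\<bar> * \<bar>y j\<bar> * b i j \<le> (y i)\<^sup>2 * b i j / 2 + (y j)\<^sup>2 * b j i / 2"
      unfolding sym[of j i] by (simp add: power2_diff algebra_simps)
  qed
  also have "\<dots> = (\<Sum>i\<in>UNIV. \<Sum>j\<in>UNIV - {i}. (y i)\<^sup>2 * b i j)"
  proof -
    have "(\<Sum>i\<in>UNIV. \<Sum>j\<in>UNIV - {i}. (y j)\<^sup>2 * b j i / 2) = (\<Sum>i\<in>UNIV. \<Sum>j\<in>UNIV - {i}. (y i)\<^sup>2 * b i j / 2)"
      by (simp add: sum_diff1 sum_subtractf) (rule sum.swap)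
    then show ?thesis by (simp add: sum.distrib flip: sum_divide_distrib)
  qed
  also have "\<dots> \<le> (\<Sum>i\<in>UNIV. (y i)\<^sup>2 * R)"
    unfolding sum_distrib_left[symmetric] by (intro sum_mono mult_left_mono row) simp
  finally show ?thesis by (simp add: sum_distrib_left mult.commute)
qed

locale quartic_gibbs = quartic_form F \<tau> for F :: "real ^ 'n::finite \<Rightarrow> _" and \<tau> +
  fixes m :: "real ^ 'n \<Rightarrow> real" and c :: real
  assumes c: "0 < c" and m: "x \<in> cube \<Longrightarrow> m x = c * exp (F x x x x)"
    and small: "real CARD('n) * \<tau> \<le> 1 / 56"
begin

sublocale cube_weight m
  by unfold_locales (simp add: m c)

lemma coupling_eq:
  assumes "x \<in> cube" "i \<noteq> j"
  shows "coupling i j x = 1 - exp (- (4 * x $ i * x $ j * hess x i j))"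
proof -
  have "m (flip i x) * m (flip j x) / (m x * m (flip i (flip j x)))
    = exp (- (4 * x $ i * x $ j * hess x i j))"
    using c assms(1) unfolding flip_second_difference[OF assms, symmetric]
    by (simp add: m exp_diff exp_add exp_minus field_simps)
  then show ?thesis by (simp add: coupling_def)
qed

text \<open>The leading term contributes \<open>4 * 36 \<theta>\<close>, the remainder
  \<open>12 * 19^2 \<theta>^2\<close> by the Schur test on the rows. With
  \<open>\<theta> \<le> 1/56\<close> the total stays below
  \<open>224 \<theta> = 4 * 56 \<theta>\<close>.\<close>

lemma kernel_form_le:
  assumes x: "x \<in> cube"
  shows "(\<Sum>i\<in>UNIV. \<Sum>j\<in>UNIV - {i}. y i * y j * kernel i j x)
    \<le> 4 * (56 * real CARD('n) * \<tau>) * (\<Sum>i\<in>UNIV. (y i)\<^sup>2)"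
proof -
  define \<theta> where "\<theta> = real CARD('n) * \<tau>"
  have th: "0 \<le> \<theta>" "\<theta> \<le> 1 / 56" using tau_nonneg small by (simp_all add: \<theta>_def)
  let ?X = "\<lambda>i j. 4 * x $ i * x $ j * hess x i j"
  let ?Y = "\<Sum>i\<in>UNIV. (y i)\<^sup>2"
  have aX: "\<bar>?X i j\<bar> = 4 * \<bar>hess x i j\<bar>" for i j
    by (simp add: abs_mult abs_cube_component[OF x])
  have rem: "\<bar>kernel i j x - ?X i j\<bar> \<le> 12 * (hess x i j)\<^sup>2" if "i \<noteq> j" for i j
  proof -
    have c01: "0 \<le> cond i x" "cond i x \<le> 1" for i
      using pos[OF x] pos[of "flip i x"] x by (simp_all add: cond_def)
    \<comment> \<open>\<open>3/7 = 4 * 6 / 56\<close>, from the entrywise Hessian bound.\<close>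
    have "\<bar>?X i j\<bar> \<le> 3 / 7"
      unfolding aX using abs_hess_le[OF x that] th by (simp add: \<theta>_def)
    then have "\<bar>kernel i j x - ?X i j\<bar> \<le> 3 / 4 * (?X i j)\<^sup>2"
      unfolding kernel_def coupling_eq[OF x that]
      by (rule abs_kernel_remainder_le) (use c01 in \<open>auto intro: mult_le_one\<close>)
    also have "(?X i j)\<^sup>2 = 16 * (hess x i j)\<^sup>2"
      using cube_component_sq[OF x] by (simp add: power_mult_distrib)
    finally show ?thesis by simp
  qed
  have "(\<Sum>i\<in>UNIV. \<Sum>j\<in>UNIV - {i}. y i * y j * kernel i j x)
    \<le> (\<Sum>i\<in>UNIV. \<Sum>j\<in>UNIV - {i}. 4 * ((x $ i * y i) * (x $ j * y j) * hess x i j)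
        + \<bar>y i\<bar> * \<bar>y j\<bar> * (12 * (hess x i j)\<^sup>2))"
  proof (intro sum_mono)
    fix i j :: 'n assume "j \<in> UNIV - {i}"
    then have "\<bar>y i * y j * (kernel i j x - ?X i j)\<bar> \<le> \<bar>y i\<bar> * \<bar>y j\<bar> * (12 * (hess x i j)\<^sup>2)"
      unfolding abs_mult by (intro mult_left_mono rem) auto
    then have "y i * y j * (kernel i j x - ?X i j) \<le> \<bar>y i\<bar> * \<bar>y j\<bar> * (12 * (hess x i j)\<^sup>2)"
      by linarith
    then show "y i * y j * kernel i j x \<le> 4 * ((x $ i * y i) * (x $ j * y j) * hess x i j)
        + \<bar>y i\<bar> * \<bar>y j\<bar> * (12 * (hess x i j)\<^sup>2)"
      by (simp add: algebra_simps)
  qed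
  also have "\<dots> = 4 * (\<Sum>i\<in>UNIV. \<Sum>j\<in>UNIV - {i}. (x $ i * y i) * (x $ j * y j) * hess x i j)
      + (\<Sum>i\<in>UNIV. \<Sum>j\<in>UNIV - {i}. \<bar>y i\<bar> * \<bar>y j\<bar> * (12 * (hess x i j)\<^sup>2))"
    by (simp only: sum.distrib sum_distrib_left)
  also have "(\<Sum>i\<in>UNIV. \<Sum>j\<in>UNIV - {i}. (x $ i * y i) * (x $ j * y j) * hess x i j) \<le> 36 * \<theta> * ?Y"
  proof -
    \<comment> \<open>The signs of \<open>x\<close> are absorbed into the test vector, whose norm
      they preserve.\<close>
    define u :: "real ^ 'n" where "u = (\<chi> i. x $ i * y i)"
    have "(norm u)\<^sup>2 = ?Y"
      unfolding power2_norm_eq_sum by (simp add: u_def power_mult_distrib cube_component_sq[OF x])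
    then show ?thesis using hess_quadratic_le[OF x, of u] by (simp add: u_def \<theta>_def)
  qed
  also have "(\<Sum>i\<in>UNIV. \<Sum>j\<in>UNIV - {i}. \<bar>y i\<bar> * \<bar>y j\<bar> * (12 * (hess x i j)\<^sup>2)) \<le> (12 * (19 * \<theta>)\<^sup>2) * ?Y"
  proof (rule schur_test)
    show "(\<Sum>j\<in>UNIV - {i}. 12 * (hess x i j)\<^sup>2) \<le> 12 * (19 * \<theta>)\<^sup>2" for i
      unfolding sum_distrib_left[symmetric] \<theta>_def using hess_row_le[OF x, of i] by simp
  qed (simp, metis hess_sym)
  also have "4 * (36 * \<theta> * ?Y) + (12 * (19 * \<theta>)\<^sup>2) * ?Y = (144 * \<theta> + 4332 * (\<theta> * \<theta>)) * ?Y"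
    by (simp add: power2_eq_square algebra_simps)
  also have "\<dots> \<le> (224 * \<theta>) * ?Y"
  proof (rule mult_right_mono)
    have "\<theta> * \<theta> \<le> \<theta> * (1 / 56)" using th by (intro mult_left_mono)
    then show "144 * \<theta> + 4332 * (\<theta> * \<theta>) \<le> 224 * \<theta>" using th(1) by linarith
  qed (simp add: sum_nonneg)
  finally show ?thesis by (simp add: \<theta>_def)
qed

end

section \<open>From tensors to quartic forms, and the conclusion\<close>

lemma tensor_form_swap:
  assumes "symmetric_tensor T"
  shows "tensor_form T x y z w = tensor_form T y x z w"
    and "tensor_form T x y z w = tensor_form T x z y w"
    and "tensor_form T x y z w = tensor_form T x y w z"
proof -
  have perm: "T $ i (p 0) $ i (p 1) $ i (p 2) $ i (p 3) = T $ i 0 $ i 1 $ i 2 $ i 3"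
    if "p permutes {..<4}" for i :: "nat \<Rightarrow> 'a" and p
    using assms that unfolding symmetric_tensor_def by blast
  define l where "l a b c d = (\<lambda>k::nat. if k = 0 then a else if k = 1 then b else if k = 2 then c else d)"
    for a b c d :: 'a
  have 1: "T $ a $ b $ c $ d = T $ b $ a $ c $ d" for a b c d
    using perm[OF permutes_swap_id[of 0 _ 1], of "l b a c d"] by (simp add: l_def Transposition.transpose_def)
  have 2: "T $ a $ b $ c $ d = T $ a $ c $ b $ d" for a b c d
    using perm[OF permutes_swap_id[of 1 _ 2], of "l a c b d"] by (simp add: l_def Transposition.transpose_def)
  show "tensor_form T x y z w = tensor_form T y x z w"
    unfolding tensor_form_def by (subst sum.swap, intro sum.cong refl, subst 1) (simp add: mult_ac)
  show "tensor_form T x y z w = tensor_form T x z y w"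
    unfolding tensor_form_def
    by (rule sum.cong[OF refl], subst sum.swap, intro sum.cong refl, subst 2) (simp add: mult_ac)
  show "tensor_form T x y z w = tensor_form T x y w z"
    unfolding tensor_form_def
    by (rule sum.cong[OF refl], rule sum.cong[OF refl], subst sum.swap, intro sum.cong refl,
        subst symmetric_tensor_swap34[OF assms]) (simp add: mult_ac)
qed

lemma tensor_form_scale:
  "tensor_form T (a *\<^sub>R x) (b *\<^sub>R y) (c *\<^sub>R z) (d *\<^sub>R w) = a * b * c * d * tensor_form T x y z w"
  unfolding tensor_form_def sum_distrib_left by (intro sum.cong refl) (simp add: mult_ac)

text \<open>On unit vectors the form is bounded by the sum of the absolute entries, so the supremum
  is a genuine upper bound; homogeneity does the rest.\<close>

lemma abs_tensor_form_le_inj_norm: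
  "\<bar>tensor_form T x y z w\<bar> \<le> inj_norm T * (norm x * norm y * norm z * norm w)"
proof (cases "x = 0 \<or> y = 0 \<or> z = 0 \<or> w = 0")
  case True
  then show ?thesis by (auto simp: tensor_form_def)
next
  case False
  let ?S = "{\<bar>tensor_form T x y z w\<bar> | x y z w. norm x = 1 \<and> norm y = 1 \<and> norm z = 1 \<and> norm w = 1}"
  let ?M = "\<Sum>i\<in>UNIV. \<Sum>j\<in>UNIV. \<Sum>k\<in>UNIV. \<Sum>l\<in>UNIV. \<bar>T $ i $ j $ k $ l\<bar>"
  have "\<bar>tensor_form T x y z w\<bar> \<le> ?M"
    if "norm x = 1" "norm y = 1" "norm z = 1" "norm w = 1" for x y z w
    unfolding tensor_form_def
  proof (intro order_trans[OF sum_abs] sum_mono)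
    fix i j k l
    have "\<bar>x $ i\<bar> \<le> 1" "\<bar>y $ j\<bar> \<le> 1" "\<bar>z $ k\<bar> \<le> 1" "\<bar>w $ l\<bar> \<le> 1"
      using that component_le_norm_cart by metis+
    then have "\<bar>x $ i\<bar> * \<bar>y $ j\<bar> * \<bar>z $ k\<bar> * \<bar>w $ l\<bar> \<le> 1"
      by (intro mult_le_one) auto
    then show "\<bar>T $ i $ j $ k $ l * x $ i * y $ j * z $ k * w $ l\<bar> \<le> \<bar>T $ i $ j $ k $ l\<bar>"
      using mult_left_mono[of "\<bar>x $ i\<bar> * \<bar>y $ j\<bar> * \<bar>z $ k\<bar> * \<bar>w $ l\<bar>" 1 "\<bar>T $ i $ j $ k $ l\<bar>"]
      by (simp add: abs_mult mult.assoc)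
  qed
  then have bdd: "bdd_above ?S" by (intro bdd_aboveI[of _ ?M]) auto
  have "\<bar>tensor_form T (sgn x) (sgn y) (sgn z) (sgn w)\<bar> \<le> inj_norm T"
    unfolding inj_norm_def using False by (intro cSup_upper bdd) (auto intro!: exI simp: norm_sgn)
  then have "norm x * norm y * norm z * norm w * \<bar>tensor_form T (sgn x) (sgn y) (sgn z) (sgn w)\<bar>
    \<le> norm x * norm y * norm z * norm w * inj_norm T"
    by (intro mult_left_mono) auto
  moreover have "tensor_form T x y z w
    = norm x * norm y * norm z * norm w * tensor_form T (sgn x) (sgn y) (sgn z) (sgn w)"
    using False unfolding tensor_form_scale[symmetric] by (simp add: sgn_div_norm)
  ultimately show ?thesis
    by (simp add: abs_mult mult.commute)
qed

lemma quartic_form_tensor_form: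
  assumes "symmetric_tensor T" "pos_def_tensor T"
  shows "quartic_form (tensor_form T) (inj_norm T)"
proof
  fix a a' b c d :: "real ^ 'a" and r :: real
  show "tensor_form T (a + a') b c d = tensor_form T a b c d + tensor_form T a' b c d"
    unfolding tensor_form_def by (simp add: algebra_simps sum.distrib)
  show "tensor_form T (r *\<^sub>R a) b c d = r * tensor_form T a b c d"
    using tensor_form_scale[of T r a 1 b 1 c 1 d] by simp
  show "tensor_form T a b c d = tensor_form T b a c d" "tensor_form T a b c d = tensor_form T a c b d"
    "tensor_form T a b c d = tensor_form T a b d c"
    using tensor_form_swap[OF assms(1)] by blast+
  show "\<bar>tensor_form T a b c d\<bar> \<le> inj_norm T * (norm a * norm b * norm c * norm d)"
    by (rule abs_tensor_form_le_inj_norm)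
  have "0 \<le> tensor_form T a b a b"
    using assms(2) unfolding pos_def_tensor_def tensor_form_eq_hs_inner by blast
  then show "0 \<le> tensor_form T a a b b"
    using tensor_form_swap(2)[OF assms(1)] by metis
qed

theorem theorem1p2:
  fixes T :: "'n::finite tensor4" and \<mu> :: "(real ^ 'n) pmf"
  assumes "symmetric_tensor T"
    and "pos_def_tensor T"
    and "set_pmf \<mu> \<subseteq> cube"
    and "propto_on cube (pmf \<mu>) (\<lambda>x. exp (tensor_diag T x))"
    and "inj_norm T \<le> 1 / (56 * real CARD('n))"
  shows "poincare_constant \<mu> \<le> 1 / ereal (1 - 56 * real CARD('n) * inj_norm T)"
proof (cases "56 * real CARD('n) * inj_norm T = 1")
  case True
  \<comment> \<open>In the boundary case the right-hand side is \<open>1 / 0 = \<infinity>\<close>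
    in \<open>ereal\<close>.\<close>
  then show ?thesis by (simp add: one_divide_ereal_zero)
next
  case False
  let ?d = "56 * real CARD('n) * inj_norm T"
  have n: "0 < real CARD('n)" by simp
  then have le1: "?d \<le> 1" using assms(5) by (simp add: field_simps)
  then have lt1: "0 < 1 - ?d" using False by simp
  obtain c where c: "0 < c" "\<And>x. x \<in> cube \<Longrightarrow> pmf \<mu> x = c * exp (tensor_form T x x x x)"
    using assms(4) unfolding propto_on_def tensor_diag_def by blast
  interpret quartic_form "tensor_form T" "inj_norm T"
    by (rule quartic_form_tensor_form[OF assms(1,2)])
  interpret quartic_gibbs "tensor_form T" "inj_norm T" "pmf \<mu>" c
    by unfold_locales (use c le1 in auto)
  have expect: "measure_pmf.expectation \<mu> g = (\<Sum>x\<in>cube. pmf \<mu> x * g x)" for g :: "real ^ 'n \<Rightarrow> real"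
    by (subst integral_measure_pmf[of cube]) (use assms(3) in \<open>auto simp: set_pmf_iff\<close>)
  have prob: "(\<Sum>x\<in>cube. pmf \<mu> x) = 1"
    using assms(3) by (intro sum_pmf_eq_1) auto
  have d0: "0 \<le> ?d" using tau_nonneg by simp
  have "poincare_ineq \<mu> (1 / (1 - ?d))"
    unfolding poincare_ineq_def
  proof
    fix \<phi> :: "real ^ 'n \<Rightarrow> real"
    have "(\<Sum>x\<in>cube. pmf \<mu> x * (\<phi> x - (\<Sum>y\<in>cube. pmf \<mu> y * \<phi> y))\<^sup>2) \<le> 1 / (1 - ?d) * energy \<phi> \<phi>"
      by (intro poincare_of_generator_bound prob lt1 generator_norm_ge d0 kernel_form_le)
    then show "measure_pmf.variance \<mu> \<phi> \<le> 1 / (1 - ?d) * dirichlet_form \<mu> \<phi>"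
      unfolding expect energy_eq_edges dirichlet_form_def .
  qed
  then have "poincare_constant \<mu> \<le> ereal (1 / (1 - ?d))"
    using lt1 by (subst poincare_constant_le_iff) auto
  also have "\<dots> = 1 / ereal (1 - ?d)"
    using lt1 by (simp add: one_ereal_def)
  finally show ?thesis .
qed

end
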